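(* For each $\Delta^0_2$ random Turing degree $\mathbf{r}$ and each integer $n\geq 1$, there exist a countably supported computable probability measure $\mu$ on $2^\omega$ and a sequence $R\in\mathbf{r}$ such that (i) $R$ is Martin-Löf random with respect to $\mu$, (ii) $R$ has Cantor-Bendixson rank $n$, and (iii) the support of $\mu$ is rank-faithful.
   Context: A Turing degree is a $\Delta^0_2$ random degree if it is $\Delta^0_2$ and contains a Martin-Löf random sequence (random with respect to the Lebesgue measure). A measure $\mu$ on $2^\omega$ is computable if $\sigma\mapsto\mu(\llbracket\sigma\rrbracket)$ is computable as a real-valued function; it is countably supported if there is a countable set $\{X_i\colon i\in\omega\}$ with $\mu(\{X_i\colon i\in\omega\})=1$. For computable $\mu$, a $\mu$-Martin-Löf test is a uniformly $\Sigma^0_1$ sequence of open sets $(\mathcal U_i)$ with $\mu(\mathcal U_i)\le 2^{-i}$; $X$ is random with respect to $\mu$ if $X\notin\bigcap_i\mathcal U_i$ for every such test. The support of $\mu$ is $\{X\colon \forall n\ \mu(\llbracket X\upharpoonright n\rrbracket)>0\}$. For a closed set $\mathcal P$, $D(\mathcal P)$ is the set of non-isolated points of $\mathcal P$, iterated transfinitely ($D^0=\mathcal P$, $D^{\beta+1}=D(D^\beta)$, intersections at limits). For a $\Pi^0_1$ class $\mathcal P$ and $X\in\mathcal P$, $\mathit{rk}_{\mathcal P}(X)$ is the least $\beta$ with $X\in D^\beta(\mathcal P)\setminus D^{\beta+1}(\mathcal P)$. $X$ is ranked if $\mathit{rk}_{\mathcal P}(X)$ is defined for some $\Pi^0_1$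 class $\mathcal P$, and its Cantor-Bendixson rank $\mathit{rk}(X)$ is the least such value over all $\Pi^0_1$ classes. A $\Pi^0_1$ class $\mathcal P$ is rank-faithful if $\mathit{rk}(X)=\mathit{rk}_{\mathcal P}(X)$ for all ranked $X\in\mathcal P$. *)

theory Defs
  imports "HOL-Probability.Probability"
begin

section \<open>Relative computability\<close>

text \<open>Codes of partial recursive functionals. An input is a list of naturals; the code
  \<open>Orc\<close> queries the oracle, \<open>Mu f\<close> is unbounded search on the first argument of \<open>f\<close>, and
  \<open>PrimRec f g\<close> recurses on the first argument.\<close>

datatype recf = Zero | Succ | Orc | Proj nat | Comp recf "recf list" | PrimRec recf recf | Mu recf

inductive evals :: "(nat \<Rightarrow> bool) \<Rightarrow> recf \<Rightarrow> nat list \<Rightarrow> nat \<Rightarrow> bool" for A where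
  zero: "evals A Zero xs 0"
| succ: "evals A Succ [x] (Suc x)"
| orc: "evals A Orc [x] (of_bool (A x))"
| proj: "i < length xs \<Longrightarrow> evals A (Proj i) xs (xs ! i)"
| comp: "\<lbrakk>length ys = length gs; \<forall>i<length gs. evals A (gs ! i) xs (ys ! i); evals A f ys z\<rbrakk>
    \<Longrightarrow> evals A (Comp f gs) xs z"
| primrec_0: "evals A f xs z \<Longrightarrow> evals A (PrimRec f g) (0 # xs) z"
| primrec_Suc: "\<lbrakk>evals A (PrimRec f g) (n # xs) y; evals A g (n # y # xs) z\<rbrakk>
    \<Longrightarrow> evals A (PrimRec f g) (Suc n # xs) z"
| mu: "\<lbrakk>evals A f (n # xs) 0; \<forall>m<n. \<exists>y>0. evals A f (m # xs) y\<rbrakk> \<Longrightarrow> evals A (Mu f) xs n"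

inductive_cases evals_ZeroE: "evals A Zero xs z"
inductive_cases evals_SuccE: "evals A Succ xs z"
inductive_cases evals_OrcE: "evals A Orc xs z"
inductive_cases evals_ProjE: "evals A (Proj i) xs z"
inductive_cases evals_CompE: "evals A (Comp f gs) xs z"
inductive_cases evals_PrimRec0E: "evals A (PrimRec f g) (0 # xs) z"
inductive_cases evals_PrimRecSucE: "evals A (PrimRec f g) (Suc n # xs) z"
inductive_cases evals_MuE: "evals A (Mu f) xs z"

lemma evals_deterministic:
  assumes "evals A e xs y" "evals A e xs z"
  shows "y = z"
  using assms
proof (induction arbitrary: z rule: evals.induct)
  case (comp ys gs xs f w)
  from comp.prems obtain ys' where ys': "length ys' = length gs"
    "\<forall>i<length gs. evals A (gs ! i) xs (ys' ! i)" "evals A f ys' z"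
    by (elim evals_CompE) blast
  have "ys = ys'"
    using comp ys' by (intro nth_equalityI) auto
  then show ?case using comp ys' by blast
next
  case (mu f n xs)
  from mu.prems have z: "evals A f (z # xs) 0" "\<forall>m<z. \<exists>y>0. evals A f (m # xs) y"
    by (auto elim: evals_MuE)
  show ?case
  proof (rule linorder_cases[of n z])
    assume "n < z"
    then obtain y where "y > 0" "evals A f (n # xs) y" using z(2) by blast
    moreover have "0 = y" by (rule mu.IH(1)) fact
    ultimately show ?thesis by simp
  next
    assume "z < n"
    then obtain y where "y > 0" "\<forall>w. evals A f (z # xs) w \<longrightarrow> y = w" using mu.IH(2) by blast
    then show ?thesis using z(1) by blast
  qed simp
next
  case zero then show ?case by (elim evals_ZeroE) simp
next
  case succ then show ?case by (elim evals_SuccE) simp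
next
  case orc then show ?case by (elim evals_OrcE) simp
next
  case proj then show ?case by (elim evals_ProjE) simp
next
  case (primrec_0 f xs z g)
  from primrec_0.prems primrec_0.IH show ?case by (elim evals_PrimRec0E) simp
next
  case (primrec_Suc f g n xs y w)
  from primrec_Suc.prems obtain y' where "evals A (PrimRec f g) (n # xs) y'"
    "evals A g (n # y' # xs) z" by (elim evals_PrimRecSucE) simp
  moreover from this(1) have "y = y'" by (rule primrec_Suc.IH(1))
  ultimately show ?case using primrec_Suc.IH(2) by blast
qed

text \<open>Computability of a total function of \<open>k\<close> arguments, without oracle.\<close>

definition computable :: "nat \<Rightarrow> (nat list \<Rightarrow> nat) \<Rightarrow> bool" where
  "computable k f \<longleftrightarrow> (\<exists>e. \<forall>xs. length xs = k \<longrightarrow> evals (\<lambda>_. False) e xs (f xs))"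

definition turing_le :: "(nat \<Rightarrow> bool) \<Rightarrow> (nat \<Rightarrow> bool) \<Rightarrow> bool"  (infix \<open>\<le>\<^sub>T\<close> 50) where
  "X \<le>\<^sub>T Y \<longleftrightarrow> (\<exists>e. \<forall>n. evals Y e [n] (of_bool (X n)))"

definition turing_equiv :: "(nat \<Rightarrow> bool) rel" where
  "turing_equiv = {(X, Y). X \<le>\<^sub>T Y \<and> Y \<le>\<^sub>T X}"

primrec subst_orc :: "recf \<Rightarrow> recf \<Rightarrow> recf" where
  "subst_orc d Zero = Zero"
| "subst_orc d Succ = Succ"
| "subst_orc d Orc = d"
| "subst_orc d (Proj i) = Proj i"
| "subst_orc d (Comp f gs) = Comp (subst_orc d f) (map (subst_orc d) gs)"
| "subst_orc d (PrimRec f g) = PrimRec (subst_orc d f) (subst_orc d g)"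
| "subst_orc d (Mu f) = Mu (subst_orc d f)"

lemma evals_subst_orc:
  assumes "evals Y e xs z" and d: "\<And>n. evals Z d [n] (of_bool (Y n))"
  shows "evals Z (subst_orc d e) xs z"
  using assms(1)
proof (induction rule: evals.induct)
  case (comp ys gs xs f z)
  then show ?case by (auto intro!: evals.comp[of ys])
next
  case (orc x)
  show ?case using d by simp
qed (auto intro: evals.intros)

lemma turing_le_trans: "X \<le>\<^sub>T Y \<Longrightarrow> Y \<le>\<^sub>T Z \<Longrightarrow> X \<le>\<^sub>T Z"
  unfolding turing_le_def using evals_subst_orc by meson

lemma turing_le_refl: "X \<le>\<^sub>T X"
  unfolding turing_le_def by (blast intro: evals.orc)

lemma equiv_turing_equiv: "equiv UNIV turing_equiv"
  by (auto simp: turing_equiv_def intro!: equivI refl_onI symI transI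
      intro: turing_le_refl turing_le_trans)

definition turing_degrees :: "(nat \<Rightarrow> bool) set set" where
  "turing_degrees = UNIV // turing_equiv"


section \<open>The arithmetical hierarchy\<close>

text \<open>\<open>Sigma_pred n k P\<close>: the \<open>k\<close>-ary predicate \<open>P\<close> is \<open>\<Sigma>\<^sup>0\<^sub>n\<close>. In the recursion, \<open>Q\<close> is
  \<open>\<Pi>\<^sup>0\<^sub>n\<close>, expressed through its complement. The variable bound by the outermost
  quantifier is prepended to the arguments. Only the values of \<open>P\<close> on lists of length \<open>k\<close> matter.\<close>

fun Sigma_pred :: "nat \<Rightarrow> nat \<Rightarrow> (nat list \<Rightarrow> bool) \<Rightarrow> bool" where
  "Sigma_pred 0 k P \<longleftrightarrow> computable k (\<lambda>xs. of_bool (P xs))"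
| "Sigma_pred (Suc n) k P \<longleftrightarrow>
     (\<exists>Q. Sigma_pred n (Suc k) (\<lambda>xs. \<not> Q xs) \<and> (\<forall>xs. length xs = k \<longrightarrow> (P xs \<longleftrightarrow> (\<exists>a. Q (a # xs)))))"

definition Pi_pred :: "nat \<Rightarrow> nat \<Rightarrow> (nat list \<Rightarrow> bool) \<Rightarrow> bool" where
  "Pi_pred n k P \<longleftrightarrow> Sigma_pred n k (\<lambda>xs. \<not> P xs)"

definition Delta02 :: "(nat \<Rightarrow> bool) \<Rightarrow> bool" where
  "Delta02 X \<longleftrightarrow> Sigma_pred 2 1 (\<lambda>xs. X (xs ! 0)) \<and> Pi_pred 2 1 (\<lambda>xs. X (xs ! 0))"


section \<open>Effectively open sets in Cantor space\<close>

text \<open>A bijection between binary strings and natural numbers (bijective base-2 notation).\<close>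

fun str_code :: "bool list \<Rightarrow> nat" where
  "str_code [] = 0"
| "str_code (b # \<sigma>) = 2 * str_code \<sigma> + (if b then 2 else 1)"

lemma bij_str_code: "bij str_code"
proof (rule bijI)
  have "str_code \<sigma> = str_code \<tau> \<Longrightarrow> \<sigma> = \<tau>" for \<sigma> \<tau>
  proof (induction \<sigma> arbitrary: \<tau>)
    case Nil then show ?case by (cases \<tau>) (auto split: if_splits)
  next
    case (Cons b \<sigma>)
    from Cons.prems obtain c \<tau>' where \<tau>: "\<tau> = c # \<tau>'" by (cases \<tau>) (auto split: if_splits)
    have "2 * m + 2 \<noteq> 2 * k + Suc 0" for m k :: nat by presburger
    with Cons.prems \<tau> have "b = c \<and> str_code \<sigma> = str_code \<tau>'"
      by (cases b; cases c) (simp_all, metis+)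
    with Cons.IH \<tau> show ?case by auto
  qed
  then show "inj str_code" by (auto intro: injI)
  have "\<exists>\<sigma>. str_code \<sigma> = n" for n
  proof (induction n rule: less_induct)
    case (less n)
    consider "n = 0" | m where "n = 2 * m + 1" | m where "n = 2 * m + 2"
      by atomize_elim presburger
    then show ?case
    proof cases
      case 1 then show ?thesis by (metis str_code.simps(1))
    next
      case (2 m)
      then obtain \<sigma> where "str_code \<sigma> = m" using less[of m] by auto
      then have "str_code (False # \<sigma>) = n" using 2 by simp
      then show ?thesis by blast
    next
      case (3 m)
      then obtain \<sigma> where "str_code \<sigma> = m" using less[of m] by auto
      then have "str_code (True # \<sigma>) = n" using 3 by simp
      then show ?thesis by blast
    qed
  qed
  then show "surj str_code" by (metis surjI)
qed

definition cylinder :: "bool list \<Rightarrow> (nat \<Rightarrow> bool) set" where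
  "cylinder \<sigma> = {X. \<forall>i<length \<sigma>. X i = \<sigma> ! i}"

definition restr :: "(nat \<Rightarrow> bool) \<Rightarrow> nat \<Rightarrow> bool list" where
  "restr X n = map X [0..<n]"

definition uniformly_Sigma01 :: "(nat \<Rightarrow> (nat \<Rightarrow> bool) set) \<Rightarrow> bool" where
  "uniformly_Sigma01 U \<longleftrightarrow> (\<exists>W :: nat \<Rightarrow> bool list \<Rightarrow> bool.
     Sigma_pred 1 2 (\<lambda>xs. W (xs ! 0) (inv str_code (xs ! 1))) \<and>
     (\<forall>i. U i = (\<Union>\<sigma>\<in>{\<sigma>. W i \<sigma>}. cylinder \<sigma>)))"

definition Pi01_class :: "(nat \<Rightarrow> bool) set \<Rightarrow> bool" where
  "Pi01_class P \<longleftrightarrow> (\<exists>W :: bool list \<Rightarrow> bool.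
     Sigma_pred 1 1 (\<lambda>xs. W (inv str_code (xs ! 0))) \<and>
     P = - (\<Union>\<sigma>\<in>{\<sigma>. W \<sigma>}. cylinder \<sigma>))"

lemma open_cylinder: "open (cylinder \<sigma>)"
proof -
  have "cylinder \<sigma> = Pi\<^sub>E UNIV (\<lambda>i. if i < length \<sigma> then {\<sigma> ! i} else UNIV)"
    by (auto simp: cylinder_def PiE_def Pi_def split: if_splits)
  moreover have "finite {i. (if i < length \<sigma> then {\<sigma> ! i} else UNIV) \<noteq> UNIV}"
    by (rule finite_subset[of _ "{..<length \<sigma>}"]) auto
  moreover have "open (if i < length \<sigma> then {\<sigma> ! i} else UNIV)" for i
    by (rule Topological_Spaces.open_discrete)
  ultimately show ?thesis
    using open_PiE[of "\<lambda>i. if i < length \<sigma> then {\<sigma> ! i} else UNIV"] by auto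
qed

lemma closed_Pi01_class: "Pi01_class P \<Longrightarrow> closed P"
  unfolding Pi01_class_def by (auto intro!: open_UN open_cylinder)


section \<open>Measures on Cantor space and randomness\<close>

instance bool :: second_countable_topology
proof
  have "(open :: bool set \<Rightarrow> bool) = generate_topology UNIV"
    by (intro ext) (simp add: Topological_Spaces.open_discrete generate_topology.Basis)
  then show "\<exists>B :: bool set set. countable B \<and> open = generate_topology B"
    by (intro exI[of _ UNIV]) simp
qed

definition lebesgue_cantor :: "(nat \<Rightarrow> bool) measure" where
  "lebesgue_cantor = (\<Pi>\<^sub>M i\<in>UNIV. measure_pmf (bernoulli_pmf (1/2)))"

lemma sets_lebesgue_cantor: "sets lebesgue_cantor = sets borel"
proof -
  have "sets (borel :: bool measure) = UNIV"
    using borel_open[OF Topological_Spaces.open_discrete] by blast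
  then have "sets lebesgue_cantor = sets (\<Pi>\<^sub>M i\<in>(UNIV::nat set). (borel :: bool measure))"
    unfolding lebesgue_cantor_def by (intro sets_PiM_cong) auto
  then show ?thesis by (simp only: sets_PiM_equal_borel)
qed

lemma prob_space_lebesgue_cantor: "prob_space lebesgue_cantor"
  unfolding lebesgue_cantor_def by (rule prob_space_PiM) (rule measure_pmf.prob_space_axioms)

definition probability_on_cantor :: "(nat \<Rightarrow> bool) measure \<Rightarrow> bool" where
  "probability_on_cantor \<mu> \<longleftrightarrow> prob_space \<mu> \<and> sets \<mu> = sets borel"

text \<open>A real-valued function on strings is computable if rational approximations, presented as
  \<open>(a - b) / (c + 1)\<close> with natural numbers \<open>a\<close>, \<open>b\<close>, \<open>c\<close>, are computable to within any \<open>2\<^sup>-\<^sup>k\<close>.\<close>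

definition computable_real_fun :: "(bool list \<Rightarrow> real) \<Rightarrow> bool" where
  "computable_real_fun F \<longleftrightarrow> (\<exists>a b c. computable 2 a \<and> computable 2 b \<and> computable 2 c \<and>
     (\<forall>\<sigma> k. let v = [str_code \<sigma>, k] in
        \<bar>(real (a v) - real (b v)) / (real (c v) + 1) - F \<sigma>\<bar> \<le> (1/2) ^ k))"

definition computable_measure :: "(nat \<Rightarrow> bool) measure \<Rightarrow> bool" where
  "computable_measure \<mu> \<longleftrightarrow> computable_real_fun (\<lambda>\<sigma>. measure \<mu> (cylinder \<sigma>))"

definition countably_supported :: "(nat \<Rightarrow> bool) measure \<Rightarrow> bool" where
  "countably_supported \<mu> \<longleftrightarrow> (\<exists>X :: nat \<Rightarrow> nat \<Rightarrow> bool. measure \<mu> (range X) = 1)"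

definition martin_lof_test :: "(nat \<Rightarrow> bool) measure \<Rightarrow> (nat \<Rightarrow> (nat \<Rightarrow> bool) set) \<Rightarrow> bool" where
  "martin_lof_test \<mu> U \<longleftrightarrow> uniformly_Sigma01 U \<and> (\<forall>i. measure \<mu> (U i) \<le> (1/2) ^ i)"

definition martin_lof_random :: "(nat \<Rightarrow> bool) measure \<Rightarrow> (nat \<Rightarrow> bool) \<Rightarrow> bool" where
  "martin_lof_random \<mu> X \<longleftrightarrow> (\<forall>U. martin_lof_test \<mu> U \<longrightarrow> X \<notin> (\<Inter>i. U i))"

definition support :: "(nat \<Rightarrow> bool) measure \<Rightarrow> (nat \<Rightarrow> bool) set" where
  "support \<mu> = {X. \<forall>n. measure \<mu> (cylinder (restr X n)) > 0}"

text \<open>A degree is \<open>\<Delta>\<^sup>0\<^sub>2\<close> if it contains a \<open>\<Delta>\<^sup>0\<^sub>2\<close> set (equivalently, all its elements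
  are \<open>\<Delta>\<^sup>0\<^sub>2\<close>).\<close>

definition Delta02_random_degree :: "(nat \<Rightarrow> bool) set \<Rightarrow> bool" where
  "Delta02_random_degree r \<longleftrightarrow>
     r \<in> turing_degrees \<and> (\<exists>X\<in>r. Delta02 X) \<and> (\<exists>X\<in>r. martin_lof_random lebesgue_cantor X)"


section \<open>Cantor-Bendixson rank\<close>

text \<open>The countable ordinals, as the elements of the first uncountable cardinal. They
  suffice to index the iterated derivatives, whose sequence becomes constant at a countable
  stage, see \<open>CB_stabilises\<close> below.\<close>

typedef cord = "Field (cardSuc natLeq)"
proof -
  have "infinite (Field (cardSuc natLeq))"
    using Cinfinite_cardSuc[OF natLeq_Cinfinite] by (simp add: cinfinite_def)
  then show ?thesis by (metis ex_in_conv finite.emptyI)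
qed

lemma Well_order_omega1: "Well_order (cardSuc natLeq)"
  using cardSuc_Card_order[OF natLeq_Card_order] unfolding card_order_on_def by blast

instantiation cord :: wellorder
begin

definition less_eq_cord :: "cord \<Rightarrow> cord \<Rightarrow> bool" where
  "\<alpha> \<le> \<beta> \<longleftrightarrow> (Rep_cord \<alpha>, Rep_cord \<beta>) \<in> cardSuc natLeq"

definition less_cord :: "cord \<Rightarrow> cord \<Rightarrow> bool" where
  "\<alpha> < \<beta> \<longleftrightarrow> \<alpha> \<le> \<beta> \<and> \<alpha> \<noteq> (\<beta> :: cord)"

instance
proof
  have wo: "wo_rel (cardSuc natLeq)" using Well_order_omega1 by (simp add: wo_rel_def)
  fix \<alpha> \<beta> \<gamma> :: cord
  show antisym: "\<alpha> \<le> \<beta> \<Longrightarrow> \<beta> \<le> \<alpha> \<Longrightarrow> \<alpha> = \<beta>" for \<alpha> \<beta> :: cord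
    using wo_rel.ANTISYM[OF wo] unfolding less_eq_cord_def antisym_def by (metis Rep_cord_inject)
  then show "\<alpha> < \<beta> \<longleftrightarrow> \<alpha> \<le> \<beta> \<and> \<not> \<beta> \<le> \<alpha>"
    unfolding less_cord_def using wo_rel.REFL[OF wo] Rep_cord
    by (metis less_eq_cord_def refl_on_def)
  show "\<alpha> \<le> \<alpha>"
    using wo_rel.REFL[OF wo] Rep_cord unfolding less_eq_cord_def refl_on_def by blast
  show "\<alpha> \<le> \<beta> \<Longrightarrow> \<beta> \<le> \<gamma> \<Longrightarrow> \<alpha> \<le> \<gamma>"
    using wo_rel.TRANS[OF wo] unfolding less_eq_cord_def trans_def by blast
  show "\<alpha> \<le> \<beta> \<or> \<beta> \<le> \<alpha>"
    using wo_rel.TOTALS[OF wo] Rep_cord unfolding less_eq_cord_def by blast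
next
  fix P :: "cord \<Rightarrow> bool" and \<alpha>
  assume step: "\<And>x. (\<And>y. y < x \<Longrightarrow> P y) \<Longrightarrow> P x"
  have "wf (cardSuc natLeq - Id)"
    using Well_order_omega1 by (simp add: well_order_on_def)
  then have "wf (inv_image (cardSuc natLeq - Id) Rep_cord)" by (rule wf_inv_image)
  then show "P \<alpha>"
  proof (induction \<alpha> rule: wf_induct_rule)
    case (less x)
    show ?case
    proof (rule step)
      fix y assume "y < x"
      then show "P y"
        by (intro less.IH) (simp add: less_cord_def less_eq_cord_def in_inv_image Rep_cord_inject)
    qed
  qed
qed

end

lemma uncountable_cord:
  includes cardinal_syntax
  shows "\<not> countable (UNIV :: cord set)"
proof
  assume "countable (UNIV :: cord set)"
  then have "countable (range Rep_cord)" by (rule countable_image)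
  then have "countable (Field (cardSuc natLeq))"
    by (simp only: type_definition.Rep_range[OF type_definition_cord])
  then obtain f :: "nat set \<Rightarrow> nat" where "inj_on f (Field (cardSuc natLeq))"
    unfolding countable_def by blast
  then have "|Field (cardSuc natLeq)| \<le>o |UNIV :: nat set|"
    by (rule card_of_ordLeqI) simp
  then have "|Field (cardSuc natLeq)| \<le>o natLeq"
    by (rule ordLeq_ordIso_trans[OF _ card_of_nat])
  moreover have "|Field (cardSuc natLeq)| =o cardSuc natLeq"
    by (rule card_of_Field_ordIso[OF cardSuc_Card_order[OF natLeq_Card_order]])
  ultimately have "cardSuc natLeq \<le>o natLeq"
    by (metis ordIso_ordLeq_trans ordIso_symmetric)
  then show False
    using cardSuc_greater[OF natLeq_Card_order] by (metis not_ordLess_ordLeq)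
qed

text \<open>Every initial segment is countable, so there is no largest element and successors exist.\<close>

lemma countable_below_cord:
  includes cardinal_syntax
  shows "countable {..<(\<alpha> :: cord)}"
proof -
  have "|underS (cardSuc natLeq) (Rep_cord \<alpha>)| <o cardSuc natLeq"
    using card_of_underS[OF cardSuc_Card_order[OF natLeq_Card_order]] Rep_cord by blast
  then have "|underS (cardSuc natLeq) (Rep_cord \<alpha>)| \<le>o natLeq"
    using cardSuc_ordLeq_ordLess[OF natLeq_Card_order card_of_Card_order] by blast
  then have "|underS (cardSuc natLeq) (Rep_cord \<alpha>)| \<le>o |UNIV :: nat set|"
    by (rule ordLeq_ordIso_trans[OF _ ordIso_symmetric[OF card_of_nat]])
  then have c: "countable (underS (cardSuc natLeq) (Rep_cord \<alpha>))"
    unfolding countable_def by (auto simp only: card_of_ordLeq[symmetric])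
  have "Rep_cord ` {..<\<alpha>} \<subseteq> underS (cardSuc natLeq) (Rep_cord \<alpha>)"
    by (auto simp: underS_def less_cord_def less_eq_cord_def Rep_cord_inject)
  then have "countable (Rep_cord ` {..<\<alpha>})" using c by (rule countable_subset)
  then show ?thesis by (rule countable_image_inj_on) (simp add: inj_on_def Rep_cord_inject)
qed

definition osucc :: "cord \<Rightarrow> cord" where
  "osucc \<alpha> = (LEAST \<beta>. \<alpha> < \<beta>)"

lemma osucc_greater: "\<alpha> < osucc \<alpha>"
proof -
  have "{..<\<alpha>} \<union> {\<alpha>} \<noteq> UNIV"
    using countable_below_cord[of \<alpha>] uncountable_cord
    by (metis countable_Un countable_finite finite.emptyI finite.insertI)
  then obtain \<beta> where "\<alpha> < \<beta>" by (metis Un_iff UNIV_eq_I insert_iff lessThan_iff linorder_cases)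
  then show ?thesis unfolding osucc_def by (rule LeastI)
qed

lemma less_osucc_iff: "\<beta> < osucc \<alpha> \<longleftrightarrow> \<beta> \<le> \<alpha>"
  using osucc_greater[of \<alpha>] not_less_Least[of \<beta> "\<lambda>\<beta>. \<alpha> < \<beta>"]
  by (auto simp: osucc_def[symmetric] not_less)

lemma osucc_inject: "osucc \<alpha> = osucc \<beta> \<longleftrightarrow> \<alpha> = \<beta>"
  by (metis less_osucc_iff order_antisym order_refl)

definition ozero :: cord where
  "ozero = (LEAST \<alpha>. True)"

lemma ozero_le: "ozero \<le> \<alpha>"
  unfolding ozero_def by (simp add: Least_le)

lemma osucc_neq_ozero: "osucc \<alpha> \<noteq> ozero"
  by (metis osucc_greater ozero_le not_less)

primrec ord_of_nat :: "nat \<Rightarrow> cord" where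
  "ord_of_nat 0 = ozero"
| "ord_of_nat (Suc n) = osucc (ord_of_nat n)"

definition deriv_set :: "(nat \<Rightarrow> bool) set \<Rightarrow> (nat \<Rightarrow> bool) set" where
  "deriv_set P = {X \<in> P. \<not> X isolated_in P}"

function CB :: "(nat \<Rightarrow> bool) set \<Rightarrow> cord \<Rightarrow> (nat \<Rightarrow> bool) set" where
  "CB P \<beta> =
     (if \<beta> = ozero then P
      else if \<exists>\<alpha>. \<beta> = osucc \<alpha> then deriv_set (CB P (THE \<alpha>. \<beta> = osucc \<alpha>))
      else (\<Inter>\<alpha>\<in>{..<\<beta>}. CB P \<alpha>))"
  by auto
termination
proof (relation "inv_image {(\<alpha>, \<beta>). \<alpha> < \<beta>} snd")
  show "wf (inv_image {(\<alpha> :: cord, \<beta>). \<alpha> < \<beta>} snd)"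
    by (simp add: wf)
qed (auto simp: osucc_inject osucc_greater)

declare CB.simps [simp del]

lemma CB_zero: "CB P ozero = P"
  by (simp add: CB.simps)

lemma CB_succ: "CB P (osucc \<beta>) = deriv_set (CB P \<beta>)"
  by (subst CB.simps) (auto simp: osucc_neq_ozero osucc_inject)

lemma CB_limit: "\<beta> \<noteq> ozero \<Longrightarrow> (\<And>\<alpha>. \<beta> \<noteq> osucc \<alpha>) \<Longrightarrow> CB P \<beta> = (\<Inter>\<alpha>\<in>{..<\<beta>}. CB P \<alpha>)"
  by (subst CB.simps) auto

lemma CB_antimono: "\<alpha> \<le> \<beta> \<Longrightarrow> CB P \<beta> \<subseteq> CB P \<alpha>"
proof (induction \<beta> arbitrary: \<alpha> rule: less_induct)
  case (less \<beta>)
  consider "\<alpha> = \<beta>" | \<gamma> where "\<alpha> < \<beta>" "\<beta> = osucc \<gamma>" | "\<alpha> < \<beta>" "\<And>\<gamma>. \<beta> \<noteq> osucc \<gamma>"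
    using less.prems by force
  then show ?case
  proof cases
    case (2 \<gamma>)
    then have "CB P \<gamma> \<subseteq> CB P \<alpha>" using less.IH less_osucc_iff order_refl by metis
    then show ?thesis using 2 by (auto simp: CB_succ deriv_set_def)
  next
    case 3
    then have "\<beta> \<noteq> ozero" using ozero_le not_less by metis
    then show ?thesis using 3 CB_limit[of \<beta> P] by auto
  qed simp
qed

lemma CB_stabilises: "\<exists>\<beta>. CB P (osucc \<beta>) = CB P \<beta>"
proof (rule ccontr)
  assume *: "\<nexists>\<beta>. CB P (osucc \<beta>) = CB P \<beta>"
  obtain B :: "(nat \<Rightarrow> bool) set set" where B: "countable B" "topological_basis B"
    using ex_countable_basis by blast
  have "\<exists>X U. U \<in> B \<and> U \<inter> CB P \<beta> = {X} \<and> X \<notin> CB P (osucc \<beta>)" for \<beta>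
  proof -
    obtain X where "X isolated_in CB P \<beta>"
      using * by (auto simp: CB_succ deriv_set_def)
    then obtain T where T: "open T" "T \<inter> CB P \<beta> = {X}" by (auto simp: isolated_in_def)
    then obtain U where "U \<in> B" "X \<in> U" "U \<subseteq> T"
      using topological_basisE[OF B(2), of T X] by blast
    then show ?thesis
      using T \<open>X isolated_in CB P \<beta>\<close> by (auto simp: CB_succ deriv_set_def)
  qed
  then obtain X U where XU: "\<And>\<beta>. U \<beta> \<in> B" "\<And>\<beta>. U \<beta> \<inter> CB P \<beta> = {X \<beta>}"
    "\<And>\<beta>. X \<beta> \<notin> CB P (osucc \<beta>)" by metis
  have "U \<alpha> \<noteq> U \<beta>" if "\<alpha> < \<beta>" for \<alpha> \<beta>
  proof
    assume "U \<alpha> = U \<beta>"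
    have "osucc \<alpha> \<le> \<beta>" using that less_osucc_iff not_less by metis
    then have "X \<beta> \<in> CB P (osucc \<alpha>)" "X \<beta> \<in> CB P \<alpha>"
      using CB_antimono XU(2)[of \<beta>] that by (blast, metis Int_iff insertI1 order_less_imp_le subsetD)
    then have "X \<beta> = X \<alpha>" using XU(2)[of \<alpha>] XU(2)[of \<beta>] \<open>U \<alpha> = U \<beta>\<close> by blast
    then show False using XU(3) \<open>X \<beta> \<in> CB P (osucc \<alpha>)\<close> by metis
  qed
  then have "inj U" by (metis injI linorder_neqE)
  moreover have "countable (range U)" using XU(1) B(1) by (meson countable_subset image_subsetI)
  ultimately show False using uncountable_cord countable_image_inj_on by blast
qed

text \<open>\<open>rk_in P X\<close> is defined iff \<open>has_rk_in P X\<close>; likewise \<open>rk X\<close> iff \<open>ranked X\<close>.\<close>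

definition has_rk_in :: "(nat \<Rightarrow> bool) set \<Rightarrow> (nat \<Rightarrow> bool) \<Rightarrow> bool" where
  "has_rk_in P X \<longleftrightarrow> (\<exists>\<beta>. X \<in> CB P \<beta> - CB P (osucc \<beta>))"

definition rk_in :: "(nat \<Rightarrow> bool) set \<Rightarrow> (nat \<Rightarrow> bool) \<Rightarrow> cord" where
  "rk_in P X = (LEAST \<beta>. X \<in> CB P \<beta> - CB P (osucc \<beta>))"

definition ranked :: "(nat \<Rightarrow> bool) \<Rightarrow> bool" where
  "ranked X \<longleftrightarrow> (\<exists>P. Pi01_class P \<and> X \<in> P \<and> has_rk_in P X)"

definition rk :: "(nat \<Rightarrow> bool) \<Rightarrow> cord" where
  "rk X = (LEAST \<alpha>. \<exists>P. Pi01_class P \<and> X \<in> P \<and> has_rk_in P X \<and> \<alpha> = rk_in P X)"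

text \<open>The equation \<open>rk X = rk_in P X\<close> is understood to include that the right-hand side is
  defined: a ranked element of the perfect kernel of \<open>P\<close> violates rank-faithfulness. Being a
  \<open>\<Pi>\<^sup>0\<^sub>1\<close> class is part of the notion.\<close>

definition rank_faithful :: "(nat \<Rightarrow> bool) set \<Rightarrow> bool" where
  "rank_faithful P \<longleftrightarrow>
     Pi01_class P \<and> (\<forall>X\<in>P. ranked X \<longrightarrow> has_rk_in P X \<and> rk X = rk_in P X)"

end

theory Submission
  imports Defs
begin

text \<open>Let \<open>Z\<close> be a random sequence of the degree with a computable approximation \<open>g t \<longlonglongrightarrow> Z\<close>, and
  split sequences into \<open>n\<close> columns. A total functional \<open>F\<close> compares each column of its input, stage by
  stage, with the approximation, outputs \<open>1\<close> whenever one more bit agrees and \<open>0\<close> otherwise. A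
  column of \<open>F X\<close> contains infinitely many ones iff that column of \<open>X\<close> is the one of \<open>Z\<close>, and otherwise
  it is eventually zero and isolated. Hence \<open>F\<close> has countable range, \<open>F Z\<close> is Turing equivalent to
  \<open>Z\<close> and random for the image measure, whose support is the \<open>\<Pi>\<^sup>0\<^sub>1\<close> class \<open>range F\<close>, and the rank
  of a point in that class is its number of infinite columns.

  These ranks are optimal: if \<open>X\<close> agrees with \<open>F Z\<close> on a set \<open>S\<close> of columns, then \<open>X\<close> lies in the
  \<open>card S\<close>-th derivative of every \<open>\<Pi>\<^sup>0\<^sub>1\<close> class containing it. Otherwise, by induction, \<open>X\<close> would be
  isolated among the members of the class that agree with it on all columns in \<open>S\<close> but one, hence
  computable from these columns of \<open>X\<close>, so one column of \<open>Z\<close> would be computable from others,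
  contradicting randomness.\<close>


section \<open>A calculus of recursive functions\<close>

text \<open>Arguments are read off an environment \<open>v\<close>, so that no arities have to be tracked. Binders
  shift the environment: the bound variable becomes \<open>v 0\<close>.\<close>

definition rec_fun :: "(nat \<Rightarrow> bool) \<Rightarrow> ((nat \<Rightarrow> nat) \<Rightarrow> nat) \<Rightarrow> bool" where
  "rec_fun A f \<longleftrightarrow> (\<exists>e k. \<forall>v l. k \<le> l \<longrightarrow> evals A e (map v [0..<l]) (f v))"

definition dec_pred :: "(nat \<Rightarrow> bool) \<Rightarrow> ((nat \<Rightarrow> nat) \<Rightarrow> bool) \<Rightarrow> bool" where
  "dec_pred A P \<longleftrightarrow> rec_fun A (\<lambda>v. of_bool (P v))"

named_theorems rec_intros

lemma rec_fun_var [rec_intros]: "rec_fun A (\<lambda>v. v i)"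
proof -
  have "evals A (Proj i) (map v [0..<l]) (v i)" if "Suc i \<le> l" for v l
    using evals.proj[of i "map v [0..<l]" A] that by simp
  then show ?thesis unfolding rec_fun_def by blast
qed

lemma rec_fun_compose:
  assumes "rec_fun A f" and "\<And>i. rec_fun A (h i)"
  shows "rec_fun A (\<lambda>v. f (\<lambda>i. h i v))"
proof -
  obtain e k where e: "\<And>v l. k \<le> l \<Longrightarrow> evals A e (map v [0..<l]) (f v)"
    using assms(1) unfolding rec_fun_def by blast
  obtain d m where d: "\<And>i v l. m i \<le> l \<Longrightarrow> evals A (d i) (map v [0..<l]) (h i v)"
    using assms(2) unfolding rec_fun_def by metis
  \<comment> \<open>The code \<open>e\<close> accepts any argument list of length at least
    \<open>k\<close>, so it is fed exactly \<open>k\<close> values. The sum bounds each of the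
    lengths \<open>m i\<close> that the \<open>k\<close> inner codes require.\<close>
  have "evals A (Comp e (map d [0..<k])) (map v [0..<l]) (f (\<lambda>i. h i v))"
    if "sum m {..<k} \<le> l" for v l
  proof (rule evals.comp)
    show "\<forall>i<length (map d [0..<k]). evals A (map d [0..<k] ! i) (map v [0..<l])
        (map (\<lambda>i. h i v) [0..<k] ! i)"
    proof (intro allI impI)
      fix i assume "i < length (map d [0..<k])"
      then have "i < k" by simp
      moreover from this have "m i \<le> sum m {..<k}" by (intro member_le_sum) auto
      ultimately show "evals A (map d [0..<k] ! i) (map v [0..<l]) (map (\<lambda>i. h i v) [0..<k] ! i)"
        using d[of i l v] that by simp
    qed
  qed (use e[of k "\<lambda>i. h i v"] in auto)
  then show ?thesis unfolding rec_fun_def by blast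
qed

text \<open>The lifting lemmas carry closure facts from the variables \<open>v 0\<close>,
  \<open>v 1\<close>, \<open>v 2\<close> to arbitrary recursive arguments, so that each operation
  has to be treated on variables only.\<close>

lemma rec_fun_lift1:
  assumes "rec_fun A (\<lambda>v. f (v 0))" and "rec_fun A a"
  shows "rec_fun A (\<lambda>v. f (a v))"
  using rec_fun_compose[OF assms(1), of "\<lambda>_. a"] assms(2) by simp

lemma rec_fun_lift2:
  assumes "rec_fun A (\<lambda>v. f (v 0) (v 1))" and "rec_fun A a" "rec_fun A b"
  shows "rec_fun A (\<lambda>v. f (a v) (b v))"
  using rec_fun_compose[OF assms(1), of "\<lambda>i. if i = 0 then a else b"] assms(2,3) by simp

lemma dec_pred_lift1:
  assumes "dec_pred A (\<lambda>v. P (v 0))" and "rec_fun A a"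
  shows "dec_pred A (\<lambda>v. P (a v))"
  using assms rec_fun_lift1[of A "\<lambda>x. of_bool (P x)"] unfolding dec_pred_def by simp

lemma dec_pred_lift2:
  assumes "dec_pred A (\<lambda>v. P (v 0) (v 1))" and "rec_fun A a" "rec_fun A b"
  shows "dec_pred A (\<lambda>v. P (a v) (b v))"
  using assms rec_fun_lift2[of A "\<lambda>x y. of_bool (P x y)"] unfolding dec_pred_def by simp

lemma dec_pred_lift3:
  assumes "dec_pred A (\<lambda>v. P (v 0) (v 1) (v 2))" and "rec_fun A a" "rec_fun A b" "rec_fun A c"
  shows "dec_pred A (\<lambda>v. P (a v) (b v) (c v))"
  using rec_fun_compose[OF assms(1)[unfolded dec_pred_def],
      of "\<lambda>i. if i = 0 then a else if i = 1 then b else c"] assms(2-4)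
  by (simp add: dec_pred_def)

section \<open>Arithmetic, bounded quantifiers and unbounded search\<close>

lemma rec_fun_Suc [rec_intros]:
  assumes "rec_fun A a"
  shows "rec_fun A (\<lambda>v. Suc (a v))"
proof -
  obtain e k where e: "\<And>v l. k \<le> l \<Longrightarrow> evals A e (map v [0..<l]) (a v)"
    using assms unfolding rec_fun_def by blast
  then have "evals A (Comp Succ [e]) (map v [0..<l]) (Suc (a v))" if "k \<le> l" for v l
    using that by (intro evals.comp[of "[a v]"]) (auto intro: evals.succ)
  then show ?thesis unfolding rec_fun_def by blast
qed

lemma rec_fun_const [rec_intros]: "rec_fun A (\<lambda>v. c)"
proof (induction c)
  case 0
  show ?case unfolding rec_fun_def using evals.zero by blast
next
  case (Suc c)
  then show ?case by (rule rec_fun_Suc)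
qed

lemma dec_pred_oracle:
  assumes "rec_fun A a"
  shows "dec_pred A (\<lambda>v. A (a v))"
proof -
  obtain e k where e: "\<And>v l. k \<le> l \<Longrightarrow> evals A e (map v [0..<l]) (a v)"
    using assms unfolding rec_fun_def by blast
  then have "evals A (Comp Orc [e]) (map v [0..<l]) (of_bool (A (a v)))" if "k \<le> l" for v l
    using that evals.orc[of A "a v"] by (intro evals.comp[of "[a v]"]) auto
  then show ?thesis unfolding dec_pred_def rec_fun_def by blast
qed

lemma rec_fun_rec_nat [rec_intros]:
  assumes "rec_fun A b" and "rec_fun A (\<lambda>w. s (w 0) (w 1) (\<lambda>i. w (Suc (Suc i))))" and "rec_fun A n"
  shows "rec_fun A (\<lambda>v. rec_nat (b v) (\<lambda>m y. s m y v) (n v))"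
proof -
  obtain eb kb where b: "\<And>v l. kb \<le> l \<Longrightarrow> evals A eb (map v [0..<l]) (b v)"
    using assms(1) unfolding rec_fun_def by blast
  obtain es ks where s: "\<And>v l. ks \<le> l \<Longrightarrow>
      evals A es (map v [0..<l]) (s (v 0) (v 1) (\<lambda>i. v (Suc (Suc i))))"
    using assms(2) unfolding rec_fun_def by blast
  obtain en kn where n: "\<And>v l. kn \<le> l \<Longrightarrow> evals A en (map v [0..<l]) (n v)"
    using assms(3) unfolding rec_fun_def by blast
  \<comment> \<open>\<open>PrimRec\<close> is run with exactly \<open>K\<close> parameters, enough
    for both codes; the projections in the final \<open>Comp\<close> cut longer environments down to
    these.\<close>
  define K where "K = max kb ks"
  have run: "evals A (PrimRec eb es) (m # map v [0..<K]) (rec_nat (b v) (\<lambda>m y. s m y v) m)" for v m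
  proof (induction m)
    case 0
    show ?case using b[of K v] by (auto simp: K_def intro: evals.primrec_0)
  next
    case (Suc m)
    let ?y = "rec_nat (b v) (\<lambda>m y. s m y v) m"
    have "evals A es (map (case_nat m (case_nat ?y v)) [0..<Suc (Suc K)]) (s m ?y v)"
      using s[of "Suc (Suc K)" "case_nat m (case_nat ?y v)"] by (simp add: K_def)
    moreover have "map (case_nat m (case_nat ?y v)) [0..<Suc (Suc K)] = m # ?y # map v [0..<K]"
      by (simp add: upt_conv_Cons map_Suc_upt[symmetric] del: upt_Suc)
    ultimately show ?case using Suc by (auto intro: evals.primrec_Suc)
  qed
  have "evals A (Comp (PrimRec eb es) (en # map Proj [0..<K])) (map v [0..<l])
      (rec_nat (b v) (\<lambda>m y. s m y v) (n v))" if "max kn K \<le> l" for v l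
  proof (rule evals.comp[OF _ _ run])
    show "\<forall>i<length (en # map Proj [0..<K]). evals A ((en # map Proj [0..<K]) ! i) (map v [0..<l])
        ((n v # map v [0..<K]) ! i)"
    proof (intro allI impI)
      fix i assume i: "i < length (en # map Proj [0..<K])"
      show "evals A ((en # map Proj [0..<K]) ! i) (map v [0..<l]) ((n v # map v [0..<K]) ! i)"
      proof (cases i)
        case 0 then show ?thesis using n that by simp
      next
        case (Suc j)
        then show ?thesis using evals.proj[of j "map v [0..<l]" A] i that by simp
      qed
    qed
  qed simp
  then show ?thesis unfolding rec_fun_def by blast
qed

lemma rec_fun_add [rec_intros]:
  assumes "rec_fun A a" "rec_fun A b"
  shows "rec_fun A (\<lambda>v. a v + b v)"
proof -
  have "rec_fun A (\<lambda>v. rec_nat (v 0) (\<lambda>_ y. Suc y) (v 1))" by (intro rec_intros)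
  moreover have "rec_nat x (\<lambda>_ y. Suc y) y = x + y" for x y :: nat by (induction y) auto
  ultimately have "rec_fun A (\<lambda>v. v 0 + v 1)" by simp
  then show ?thesis using assms by (rule rec_fun_lift2)
qed

lemma rec_fun_diff [rec_intros]:
  assumes "rec_fun A a" "rec_fun A b"
  shows "rec_fun A (\<lambda>v. a v - b v)"
proof -
  have "rec_fun A (\<lambda>v. rec_nat 0 (\<lambda>m _. m) (v 0))" by (intro rec_intros)
  moreover have "rec_nat 0 (\<lambda>m _. m) y = y - 1" for y :: nat by (cases y) auto
  ultimately have pred: "rec_fun A (\<lambda>v. v 0 - 1)" by simp
  have "rec_fun A (\<lambda>v. rec_nat (v 0) (\<lambda>_ y. y - 1) (v 1))"
    by (intro rec_intros rec_fun_lift1[OF pred])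
  moreover have "rec_nat x (\<lambda>_ y. y - 1) y = x - y" for x y :: nat by (induction y) auto
  ultimately have "rec_fun A (\<lambda>v. v 0 - v 1)" by simp
  then show ?thesis using assms by (rule rec_fun_lift2)
qed

lemma rec_fun_mult [rec_intros]:
  assumes "rec_fun A a" "rec_fun A b"
  shows "rec_fun A (\<lambda>v. a v * b v)"
proof -
  have "rec_fun A (\<lambda>v. rec_nat 0 (\<lambda>_ y. y + v 0) (v 1))" by (intro rec_intros)
  moreover have "rec_nat 0 (\<lambda>_ y. y + x) y = x * y" for x y :: nat by (induction y) auto
  ultimately have "rec_fun A (\<lambda>v. v 0 * v 1)" by simp
  then show ?thesis using assms by (rule rec_fun_lift2)
qed

lemma rec_fun_power [rec_intros]:
  assumes "rec_fun A a" "rec_fun A b"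
  shows "rec_fun A (\<lambda>v. a v ^ b v)"
proof -
  have "rec_fun A (\<lambda>v. rec_nat 1 (\<lambda>_ y. v 0 * y) (v 1))" by (intro rec_intros)
  moreover have "rec_nat 1 (\<lambda>_ y. x * y) y = x ^ y" for x y :: nat by (induction y) auto
  ultimately have "rec_fun A (\<lambda>v. v 0 ^ v 1)" by simp
  then show ?thesis using assms by (rule rec_fun_lift2)
qed

lemma rec_fun_of_bool [rec_intros]: "dec_pred A P \<Longrightarrow> rec_fun A (\<lambda>v. of_bool (P v))"
  unfolding dec_pred_def .

lemma dec_predI:
  assumes "rec_fun A f" "\<And>v. f v = of_bool (P v)"
  shows "dec_pred A P"
proof -
  have "f = (\<lambda>v. of_bool (P v))" using assms(2) by (rule ext)
  then show ?thesis using assms(1) unfolding dec_pred_def by simp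
qed

lemma dec_pred_const [rec_intros]: "dec_pred A (\<lambda>v. c)"
  unfolding dec_pred_def by (rule rec_fun_const)

lemma dec_pred_not [rec_intros]: "dec_pred A P \<Longrightarrow> dec_pred A (\<lambda>v. \<not> P v)"
  by (rule dec_predI[of A "\<lambda>v. 1 - of_bool (P v)"]) (intro rec_intros, simp_all)

lemma dec_pred_conj [rec_intros]:
  "dec_pred A P \<Longrightarrow> dec_pred A Q \<Longrightarrow> dec_pred A (\<lambda>v. P v \<and> Q v)"
  by (rule dec_predI[of A "\<lambda>v. of_bool (P v) * of_bool (Q v)"]) (intro rec_intros, simp_all)

lemma dec_pred_disj [rec_intros]:
  assumes "dec_pred A P" "dec_pred A Q"
  shows "dec_pred A (\<lambda>v. P v \<or> Q v)"
proof -
  have "dec_pred A (\<lambda>v. \<not> (\<not> P v \<and> \<not> Q v))" by (intro rec_intros assms)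
  then show ?thesis by simp
qed

lemma dec_pred_imp [rec_intros]:
  assumes "dec_pred A P" "dec_pred A Q"
  shows "dec_pred A (\<lambda>v. P v \<longrightarrow> Q v)"
proof -
  have "dec_pred A (\<lambda>v. \<not> P v \<or> Q v)" by (intro rec_intros assms)
  then show ?thesis by simp
qed

lemma dec_pred_iff [rec_intros]:
  assumes "dec_pred A P" "dec_pred A Q"
  shows "dec_pred A (\<lambda>v. P v \<longleftrightarrow> Q v)"
proof -
  have "dec_pred A (\<lambda>v. (P v \<longrightarrow> Q v) \<and> (Q v \<longrightarrow> P v))" by (intro rec_intros assms)
  moreover have "(\<lambda>v. (P v \<longrightarrow> Q v) \<and> (Q v \<longrightarrow> P v)) = (\<lambda>v. P v \<longleftrightarrow> Q v)" by auto
  ultimately show ?thesis by simp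
qed

lemma dec_pred_le [rec_intros]:
  "rec_fun A a \<Longrightarrow> rec_fun A b \<Longrightarrow> dec_pred A (\<lambda>v. a v \<le> b v)"
  by (rule dec_predI[of A "\<lambda>v. 1 - (a v - b v)"]) (intro rec_intros, auto)

lemma dec_pred_less [rec_intros]:
  "rec_fun A a \<Longrightarrow> rec_fun A b \<Longrightarrow> dec_pred A (\<lambda>v. a v < b v)"
  unfolding less_eq_Suc_le by (intro rec_intros)

lemma dec_pred_eq [rec_intros]:
  "rec_fun A a \<Longrightarrow> rec_fun A b \<Longrightarrow> dec_pred A (\<lambda>v. a v = b v)"
  unfolding order_eq_iff by (intro rec_intros)

lemma rec_fun_if [rec_intros]:
  assumes "dec_pred A P" "rec_fun A a" "rec_fun A b"
  shows "rec_fun A (\<lambda>v. if P v then a v else b v)"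
proof -
  have "rec_fun A (\<lambda>v. of_bool (P v) * a v + of_bool (\<not> P v) * b v)" by (intro rec_intros assms)
  moreover have "(\<lambda>v. of_bool (P v) * a v + of_bool (\<not> P v) * b v)
      = (\<lambda>v. if P v then a v else b v)" by auto
  ultimately show ?thesis by simp
qed

lemma dec_pred_ball [rec_intros]:
  assumes "dec_pred A (\<lambda>w. P (w 0) (\<lambda>i. w (Suc i)))" and "rec_fun A n"
  shows "dec_pred A (\<lambda>v. \<forall>j<n v. P j v)"
proof (rule dec_predI)
  \<comment> \<open>The recursion binds the accumulator besides the index, so the outer variables
    move up by one more place and position 1 is skipped.\<close>
  have "dec_pred A (\<lambda>w. P (w 0) (\<lambda>i. w (Suc (Suc i))))"
    using rec_fun_compose[OF assms(1)[unfolded dec_pred_def],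
        of "\<lambda>i v. v (if i = 0 then 0 else Suc i)"] rec_fun_var by (simp add: dec_pred_def)
  then show "rec_fun A (\<lambda>v. rec_nat 1 (\<lambda>m y. y * of_bool (P m v)) (n v))"
    by (intro rec_intros assms(2))
  have "rec_nat (1 :: nat) (\<lambda>m y. y * of_bool (P m v)) n = of_bool (\<forall>j<n. P j v)" for v and n :: nat
    by (induction n) (auto simp: less_Suc_eq)
  then show "rec_nat (1 :: nat) (\<lambda>m y. y * of_bool (P m v)) (n v) = of_bool (\<forall>j<n v. P j v)" for v .
qed

lemma dec_pred_bex [rec_intros]:
  assumes "dec_pred A (\<lambda>w. P (w 0) (\<lambda>i. w (Suc i)))" and "rec_fun A n"
  shows "dec_pred A (\<lambda>v. \<exists>j<n v. P j v)"
proof -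
  have "dec_pred A (\<lambda>v. \<not> (\<forall>j<n v. \<not> P j v))" by (intro rec_intros assms)
  then show ?thesis by simp
qed

lemma dec_pred_ball_le [rec_intros]:
  assumes "dec_pred A (\<lambda>w. P (w 0) (\<lambda>i. w (Suc i)))" and "rec_fun A n"
  shows "dec_pred A (\<lambda>v. \<forall>j\<le>n v. P j v)"
  unfolding less_Suc_eq_le[symmetric] by (intro rec_intros assms)

text \<open>\<open>Mu\<close> searches for a zero, hence it is applied to the characteristic
  function of the negation. Existence for every environment makes the search total.\<close>

lemma rec_fun_Least:
  assumes "dec_pred A (\<lambda>w. P (w 0) (\<lambda>i. w (Suc i)))" and ex: "\<And>v. \<exists>x. P x v"
  shows "rec_fun A (\<lambda>v. LEAST x. P x v)"
proof -
  have "rec_fun A (\<lambda>w. of_bool (\<not> P (w 0) (\<lambda>i. w (Suc i))))" by (intro rec_intros assms(1))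
  then obtain e k where e: "\<And>v l. k \<le> l \<Longrightarrow>
      evals A e (map v [0..<l]) (of_bool (\<not> P (v 0) (\<lambda>i. v (Suc i))))"
    unfolding rec_fun_def by blast
  have step: "evals A e (x # map v [0..<l]) (of_bool (\<not> P x v))" if "k \<le> l" for x v l
  proof -
    have "map (case_nat x v) [0..<Suc l] = x # map v [0..<l]"
      by (simp add: upt_conv_Cons map_Suc_upt[symmetric] del: upt_Suc)
    then show ?thesis using e[of "Suc l" "case_nat x v"] that by simp
  qed
  have "evals A (Mu e) (map v [0..<l]) (LEAST x. P x v)" if "k \<le> l" for v l
  proof (rule evals.mu)
    show "evals A e ((LEAST x. P x v) # map v [0..<l]) 0"
      using step[OF that, of "LEAST x. P x v" v] LeastI_ex[OF ex, of v] by simp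
    show "\<forall>m<LEAST x. P x v. \<exists>y>0. evals A e (m # map v [0..<l]) y"
    proof (intro allI impI)
      fix m assume "m < (LEAST x. P x v)"
      then have "\<not> P m v" by (rule not_less_Least)
      then show "\<exists>y>0. evals A e (m # map v [0..<l]) y" using step[OF that, of m v] by auto
    qed
  qed
  then show ?thesis unfolding rec_fun_def by blast
qed

lemma rec_fun_div [rec_intros]:
  assumes "rec_fun A a" "rec_fun A b"
  shows "rec_fun A (\<lambda>v. a v div b v)"
proof -
  \<comment> \<open>The first disjunct stops the search at 0 when the divisor is 0, in accordance
    with \<open>x div 0 = 0\<close>.\<close>
  have "rec_fun A (\<lambda>v. LEAST q. v 1 = 0 \<or> v 0 < Suc q * v 1)"
  proof (rule rec_fun_Least)
    show "dec_pred A (\<lambda>w. w (Suc 1) = 0 \<or> w (Suc 0) < Suc (w 0) * w (Suc 1))"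
      by (intro rec_intros)
    show "\<exists>q. v 1 = 0 \<or> v 0 < Suc q * v 1" for v :: "nat \<Rightarrow> nat"
      using dividend_less_div_times[of "v 1" "v 0"] by (intro exI[of _ "v 0 div v 1"]) auto
  qed
  moreover have "(LEAST q. y = 0 \<or> x < Suc q * y) = x div y" for x y :: nat
  proof (rule Least_equality)
    show "y = 0 \<or> x < Suc (x div y) * y" using dividend_less_div_times[of y x] by auto
    show "x div y \<le> q" if "y = 0 \<or> x < Suc q * y" for q
      using that less_mult_imp_div_less[of x "Suc q" y] by (auto simp del: mult_Suc)
  qed
  ultimately have "rec_fun A (\<lambda>v. v 0 div v 1)" by simp
  then show ?thesis using assms by (rule rec_fun_lift2)
qed

lemma rec_fun_mod [rec_intros]:
  "rec_fun A a \<Longrightarrow> rec_fun A b \<Longrightarrow> rec_fun A (\<lambda>v. a v mod b v)"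
  unfolding minus_div_mult_eq_mod[symmetric] by (intro rec_intros)

lemma dec_pred_even [rec_intros]: "rec_fun A a \<Longrightarrow> dec_pred A (\<lambda>v. even (a v))"
  unfolding even_iff_mod_2_eq_zero by (intro rec_intros)

lemma dec_pred_bit [rec_intros]:
  "rec_fun A a \<Longrightarrow> rec_fun A b \<Longrightarrow> dec_pred A (\<lambda>v. bit (a v) (b v))"
  unfolding bit_iff_odd by (intro rec_intros)

lemma dec_pred_mem_finite [rec_intros]:
  assumes "finite S" "rec_fun A a"
  shows "dec_pred A (\<lambda>v. a v \<in> S)"
  using assms(1)
proof (induction S)
  case empty
  show ?case using dec_pred_const[of A False] by simp
next
  case (insert x S)
  have "dec_pred A (\<lambda>v. a v = x \<or> a v \<in> S)" by (intro rec_intros assms insert)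
  then show ?case by simp
qed

section \<open>Passage between environments and argument lists\<close>

text \<open>The empty oracle always answers 0, so its queries can be replaced by the code
  \<open>Zero\<close>.\<close>

lemma rec_fun_any_oracle:
  assumes "rec_fun (\<lambda>_. False) f"
  shows "rec_fun A f"
proof -
  obtain e k where e: "\<And>v l. k \<le> l \<Longrightarrow> evals (\<lambda>_. False) e (map v [0..<l]) (f v)"
    using assms unfolding rec_fun_def by blast
  have "evals A (subst_orc Zero e) (map v [0..<l]) (f v)" if "k \<le> l" for v l
    by (rule evals_subst_orc[OF e[OF that]]) (simp add: evals.zero)
  then show ?thesis unfolding rec_fun_def by blast
qed

lemma dec_pred_any_oracle: "dec_pred (\<lambda>_. False) P \<Longrightarrow> dec_pred A P"
  unfolding dec_pred_def by (rule rec_fun_any_oracle)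

text \<open>In one direction projections drop the surplus arguments; in the other, zeros pad the
  list to the length that the code expects. The same device proves
  \<open>turing_le_iff\<close>.\<close>

lemma computable_iff: "computable k F \<longleftrightarrow> rec_fun (\<lambda>_. False) (\<lambda>v. F (map v [0..<k]))"
proof
  assume "computable k F"
  then obtain e where e: "\<And>xs. length xs = k \<Longrightarrow> evals (\<lambda>_. False) e xs (F xs)"
    unfolding computable_def by blast
  have "evals (\<lambda>_. False) (Comp e (map Proj [0..<k])) (map v [0..<l]) (F (map v [0..<k]))"
    if "k \<le> l" for v l
  proof (rule evals.comp)
    show "\<forall>i<length (map Proj [0..<k]). evals (\<lambda>_. False) (map Proj [0..<k] ! i) (map v [0..<l])
        (map v [0..<k] ! i)"
      using evals.proj[of _ "map v [0..<l]"] that by auto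
  qed (use e in auto)
  then show "rec_fun (\<lambda>_. False) (\<lambda>v. F (map v [0..<k]))" unfolding rec_fun_def by blast
next
  assume "rec_fun (\<lambda>_. False) (\<lambda>v. F (map v [0..<k]))"
  then obtain e l where e: "\<And>v. evals (\<lambda>_. False) e (map v [0..<l + k]) (F (map v [0..<k]))"
    unfolding rec_fun_def by (metis le_add1)
  have "evals (\<lambda>_. False) (Comp e (map Proj [0..<k] @ replicate l Zero)) xs (F xs)"
    if "length xs = k" for xs
  proof (rule evals.comp)
    let ?v = "\<lambda>i. if i < k then xs ! i else 0"
    have "map ?v [0..<k] = xs" using that by (intro nth_equalityI) auto
    moreover have "map ?v [0..<l + k] = xs @ replicate l 0"
      using that by (intro nth_equalityI) (auto simp: nth_append)
    ultimately show "evals (\<lambda>_. False) e (xs @ replicate l 0) (F xs)" using e[of ?v] by simp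
    show "\<forall>i<length (map Proj [0..<k] @ replicate l Zero).
        evals (\<lambda>_. False) ((map Proj [0..<k] @ replicate l Zero) ! i) xs ((xs @ replicate l 0) ! i)"
      using that by (auto simp: nth_append intro: evals.proj evals.zero)
  qed (use that in simp)
  then show "computable k F" unfolding computable_def by blast
qed

lemma turing_le_iff: "X \<le>\<^sub>T Y \<longleftrightarrow> dec_pred Y (\<lambda>v. X (v 0))"
proof
  assume "X \<le>\<^sub>T Y"
  then obtain e where e: "\<And>n. evals Y e [n] (of_bool (X n))" unfolding turing_le_def by blast
  have "evals Y (Comp e [Proj 0]) (map v [0..<l]) (of_bool (X (v 0)))" if "1 \<le> l" for v l
    using that e evals.proj[of 0 "map v [0..<l]" Y] by (intro evals.comp[of "[v 0]"]) auto
  then show "dec_pred Y (\<lambda>v. X (v 0))" unfolding dec_pred_def rec_fun_def by blast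
next
  assume "dec_pred Y (\<lambda>v. X (v 0))"
  then obtain e l where e: "\<And>v. evals Y e (map v [0..<Suc l]) (of_bool (X (v 0)))"
    unfolding dec_pred_def rec_fun_def by (metis le_Suc_eq order_refl)
  have "evals Y (Comp e (Proj 0 # replicate l Zero)) [n] (of_bool (X n))" for n
  proof (rule evals.comp)
    have "map (case_nat n (\<lambda>_. 0)) [0..<Suc l] = n # replicate l 0"
      by (simp add: upt_conv_Cons map_Suc_upt[symmetric] comp_def map_replicate_const del: upt_Suc)
    then show "evals Y e (n # replicate l 0) (of_bool (X n))" using e[of "case_nat n (\<lambda>_. 0)"] by simp
    show "\<forall>i<length (Proj 0 # replicate l Zero).
        evals Y ((Proj 0 # replicate l Zero) ! i) [n] ((n # replicate l 0) ! i)"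
      using evals.proj[of 0 "[n]" Y] by (auto simp: nth_Cons' intro: evals.zero)
  qed simp
  then show "X \<le>\<^sub>T Y" unfolding turing_le_def by blast
qed


section \<open>Binary strings as numbers\<close>

text \<open>Strings of length \<open>l\<close> are handled as numbers below \<open>2 ^ l\<close>,
  first bit least significant. Decoding is \<open>bit\<close>: the sequence \<open>bit b\<close> is
  the string coded by \<open>b\<close>, continued by zeros.\<close>

definition enc :: "(nat \<Rightarrow> bool) \<Rightarrow> nat \<Rightarrow> nat" where
  "enc X l = horner_sum of_bool 2 (restr X l)"

lemma length_restr [simp]: "length (restr X l) = l"
  by (simp add: restr_def)

lemma nth_restr [simp]: "i < l \<Longrightarrow> restr X l ! i = X i"
  by (simp add: restr_def)

lemma restr_nth: "restr ((!) \<sigma>) (length \<sigma>) = \<sigma>"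
  by (simp add: restr_def map_nth)

lemma restr_eq_iff: "restr X l = restr Y l \<longleftrightarrow> (\<forall>i<l. X i = Y i)"
  by (auto simp: restr_def)

lemma mem_cylinder_iff: "X \<in> cylinder \<sigma> \<longleftrightarrow> restr X (length \<sigma>) = \<sigma>"
  by (auto simp: cylinder_def list_eq_iff_nth_eq)

lemma bit_enc: "bit (enc X l) i \<longleftrightarrow> i < l \<and> X i"
  by (auto simp: enc_def bit_horner_sum_bit_iff)

lemma enc_less: "enc X l < 2 ^ l"
  using horner_sum_of_bool_2_less[of "restr X l"] by (simp add: enc_def)

lemma enc_bit: "b < 2 ^ l \<Longrightarrow> enc (bit b) l = b"
  by (simp add: enc_def restr_def horner_sum_bit_eq_take_bit take_bit_nat_eq_self)

lemma enc_cong: "(\<And>i. i < l \<Longrightarrow> X i = Y i) \<Longrightarrow> enc X l = enc Y l"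
  by (metis enc_def restr_eq_iff)

text \<open>Adding 1 turns bijective base 2 into ordinary binary: the bits of the string, topped by
  a leading 1 at position \<open>length \<sigma>\<close>. So \<open>len_code\<close> and
  \<open>inv_str_code\<close> can read length and bits off \<open>Suc c\<close>.\<close>

lemma Suc_str_code: "Suc (str_code \<sigma>) = horner_sum of_bool 2 \<sigma> + 2 ^ length \<sigma>"
  by (induction \<sigma>) auto

lemma str_code_restr: "str_code (restr X l) = enc X l + 2 ^ l - 1"
  using Suc_str_code[of "restr X l"] by (simp add: enc_def)

definition len_code :: "nat \<Rightarrow> nat" where
  "len_code c = (LEAST l. Suc c < 2 ^ Suc l)"

lemma len_code_str_code: "len_code (str_code \<sigma>) = length \<sigma>"
  unfolding len_code_def
proof (rule Least_equality)
  have "horner_sum of_bool 2 \<sigma> < (2 :: nat) ^ length \<sigma>"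
    by (rule horner_sum_of_bool_2_less)
  then show "Suc (str_code \<sigma>) < 2 ^ Suc (length \<sigma>)" by (simp add: Suc_str_code)
  show "length \<sigma> \<le> l" if "Suc (str_code \<sigma>) < 2 ^ Suc l" for l
  proof -
    have "2 ^ length \<sigma> < (2 :: nat) ^ Suc l" using that Suc_str_code[of \<sigma>] by linarith
    then show ?thesis by (simp only: power_strict_increasing_iff less_Suc_eq_le)
  qed
qed

lemma inv_str_code: "inv str_code c = restr (bit (Suc c)) (len_code c)"
proof -
  obtain \<sigma> where c: "c = str_code \<sigma>" using bij_str_code by (metis bij_pointE)
  have "bit (Suc (str_code \<sigma>)) i = \<sigma> ! i" if "i < length \<sigma>" for i
  proof -
    have "bit (Suc (str_code \<sigma>)) i = bit (take_bit (length \<sigma>) (horner_sum of_bool 2 \<sigma> + 2 ^ length \<sigma> :: nat)) i"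
      using that by (simp add: Suc_str_code bit_take_bit_iff)
    also have "take_bit (length \<sigma>) (horner_sum of_bool 2 \<sigma> + 2 ^ length \<sigma> :: nat) = horner_sum of_bool 2 \<sigma>"
      using horner_sum_of_bool_2_less[of \<sigma>, where 'a = nat] by (simp add: take_bit_eq_mod)
    finally show ?thesis using that by (simp add: bit_horner_sum_bit_iff)
  qed
  then have "\<sigma> = restr (bit (Suc c)) (len_code c)"
    by (intro nth_equalityI) (auto simp: c len_code_str_code)
  moreover have "inv str_code c = \<sigma>" using bij_str_code by (simp add: c bij_is_inj)
  ultimately show ?thesis by simp
qed

lemma restr_bit_str_code: "restr (bit (Suc (str_code \<sigma>))) (length \<sigma>) = \<sigma>"
  using inv_str_code[of "str_code \<sigma>"] bij_str_code by (simp add: bij_is_inj len_code_str_code)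

lemma rec_fun_len_code [rec_intros]:
  assumes "rec_fun A a"
  shows "rec_fun A (\<lambda>v. len_code (a v))"
proof -
  have "rec_fun A (\<lambda>v. LEAST l. Suc (v 0) < 2 ^ Suc l)"
  proof (rule rec_fun_Least)
    show "dec_pred A (\<lambda>w. Suc (w (Suc 0)) < 2 ^ Suc (w 0))" by (intro rec_intros)
    show "\<exists>l. Suc (v 0) < 2 ^ Suc l" for v :: "nat \<Rightarrow> nat"
      using less_exp[of "Suc (v 0)"] by (intro exI[of _ "Suc (v 0)"]) (simp add: less_trans)
  qed
  then show ?thesis unfolding len_code_def[symmetric] using assms by (rule rec_fun_lift1)
qed

lemma rec_fun_enc [rec_intros]:
  assumes "dec_pred A (\<lambda>w. X (\<lambda>i. w (Suc i)) (w 0))" and "rec_fun A l"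
  shows "rec_fun A (\<lambda>v. enc (X v) (l v))"
proof -
  have "rec_fun A (\<lambda>w. of_bool (X (\<lambda>i. w (Suc (Suc i))) (w 0)))"
    using rec_fun_compose[OF assms(1)[unfolded dec_pred_def],
        of "\<lambda>i v. v (if i = 0 then 0 else Suc i)"] rec_fun_var by simp
  then have "dec_pred A (\<lambda>w. X (\<lambda>i. w (Suc (Suc i))) (w 0))"
    by (simp add: dec_pred_def)
  then have "rec_fun A (\<lambda>v. rec_nat 0 (\<lambda>i y. y + of_bool (X v i) * 2 ^ i) (l v))"
    by (intro rec_intros assms(2))
  moreover have "rec_nat 0 (\<lambda>i y. y + of_bool (Y i) * 2 ^ i) l = enc Y l" for Y :: "nat \<Rightarrow> bool" and l
    by (induction l) (auto simp: enc_def restr_def horner_sum_append)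
  ultimately show ?thesis by simp
qed

lemma computable_of_bool_iff:
  "computable k (\<lambda>xs. of_bool (P xs)) \<longleftrightarrow> dec_pred (\<lambda>_. False) (\<lambda>v. P (map v [0..<k]))"
  by (simp add: computable_iff dec_pred_def)

text \<open>\<open>Sigma_pred\<close> presents its matrix through a complement and decodes strings
  with \<open>inv str_code\<close>. This normal form, with the witness first and codes in place of
  strings, fits the calculus.\<close>

lemma Sigma1_str_iff:
  "Sigma_pred 1 1 (\<lambda>xs. W (inv str_code (xs ! 0))) \<longleftrightarrow>
   (\<exists>V. dec_pred (\<lambda>_. False) (\<lambda>v. V (v 0) (v 1)) \<and> (\<forall>\<sigma>. W \<sigma> \<longleftrightarrow> (\<exists>a. V a (str_code \<sigma>))))"
proof
  assume "Sigma_pred 1 1 (\<lambda>xs. W (inv str_code (xs ! 0)))"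
  then obtain Q where Q: "computable 2 (\<lambda>xs. of_bool (\<not> Q xs))"
    "\<forall>xs. length xs = 1 \<longrightarrow> W (inv str_code (xs ! 0)) \<longleftrightarrow> (\<exists>a. Q (a # xs))"
    by (auto simp: numeral_2_eq_2)
  have "dec_pred (\<lambda>_. False) (\<lambda>v. Q [v 0, v 1])"
    using Q(1)[unfolded computable_of_bool_iff, THEN dec_pred_not] by (simp add: numeral_2_eq_2)
  moreover have "W \<sigma> \<longleftrightarrow> (\<exists>a. Q [a, str_code \<sigma>])" for \<sigma>
    using Q(2)[rule_format, of "[str_code \<sigma>]"] bij_str_code by (simp add: bij_is_inj)
  ultimately show "\<exists>V. dec_pred (\<lambda>_. False) (\<lambda>v. V (v 0) (v 1)) \<and> (\<forall>\<sigma>. W \<sigma> \<longleftrightarrow> (\<exists>a. V a (str_code \<sigma>)))"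
    by (intro exI[of _ "\<lambda>a c. Q [a, c]"]) simp
next
  assume "\<exists>V. dec_pred (\<lambda>_. False) (\<lambda>v. V (v 0) (v 1)) \<and> (\<forall>\<sigma>. W \<sigma> \<longleftrightarrow> (\<exists>a. V a (str_code \<sigma>)))"
  then obtain V where V: "dec_pred (\<lambda>_. False) (\<lambda>v. V (v 0) (v 1))"
    "\<And>\<sigma>. W \<sigma> \<longleftrightarrow> (\<exists>a. V a (str_code \<sigma>))" by blast
  have "computable 2 (\<lambda>xs. of_bool (\<not> V (xs ! 0) (xs ! 1)))"
    unfolding computable_of_bool_iff using V(1)[THEN dec_pred_not] by (simp add: numeral_2_eq_2)
  moreover have "str_code (inv str_code c) = c" for c
    using bij_str_code by (simp add: bij_is_surj surj_f_inv_f)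
  ultimately show "Sigma_pred 1 1 (\<lambda>xs. W (inv str_code (xs ! 0)))"
    by (auto simp: numeral_2_eq_2 V(2) intro!: exI[of _ "\<lambda>xs. V (xs ! 0) (xs ! 1)"])
qed

lemma Sigma1_nat_str_iff:
  "Sigma_pred 1 2 (\<lambda>xs. W (xs ! 0) (inv str_code (xs ! 1))) \<longleftrightarrow>
   (\<exists>V. dec_pred (\<lambda>_. False) (\<lambda>v. V (v 0) (v 1) (v 2)) \<and> (\<forall>i \<sigma>. W i \<sigma> \<longleftrightarrow> (\<exists>a. V a i (str_code \<sigma>))))"
proof
  assume "Sigma_pred 1 2 (\<lambda>xs. W (xs ! 0) (inv str_code (xs ! 1)))"
  then obtain Q where Q: "computable 3 (\<lambda>xs. of_bool (\<not> Q xs))"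
    "\<forall>xs. length xs = 2 \<longrightarrow> W (xs ! 0) (inv str_code (xs ! 1)) \<longleftrightarrow> (\<exists>a. Q (a # xs))"
    by (auto simp: numeral_2_eq_2 numeral_3_eq_3)
  have "dec_pred (\<lambda>_. False) (\<lambda>v. Q [v 0, v 1, v 2])"
    using Q(1)[unfolded computable_of_bool_iff, THEN dec_pred_not]
    by (simp add: numeral_2_eq_2 numeral_3_eq_3)
  moreover have "W i \<sigma> \<longleftrightarrow> (\<exists>a. Q [a, i, str_code \<sigma>])" for i \<sigma>
    using Q(2)[rule_format, of "[i, str_code \<sigma>]"] bij_str_code by (simp add: bij_is_inj)
  ultimately show "\<exists>V. dec_pred (\<lambda>_. False) (\<lambda>v. V (v 0) (v 1) (v 2)) \<and> (\<forall>i \<sigma>. W i \<sigma> \<longleftrightarrow> (\<exists>a. V a i (str_code \<sigma>)))"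
    by (intro exI[of _ "\<lambda>a i c. Q [a, i, c]"]) simp
next
  assume "\<exists>V. dec_pred (\<lambda>_. False) (\<lambda>v. V (v 0) (v 1) (v 2)) \<and> (\<forall>i \<sigma>. W i \<sigma> \<longleftrightarrow> (\<exists>a. V a i (str_code \<sigma>)))"
  then obtain V where V: "dec_pred (\<lambda>_. False) (\<lambda>v. V (v 0) (v 1) (v 2))"
    "\<And>i \<sigma>. W i \<sigma> \<longleftrightarrow> (\<exists>a. V a i (str_code \<sigma>))" by blast
  have "computable 3 (\<lambda>xs. of_bool (\<not> V (xs ! 0) (xs ! 1) (xs ! 2)))"
    unfolding computable_of_bool_iff using V(1)[THEN dec_pred_not] by (simp add: numeral_2_eq_2 numeral_3_eq_3)
  moreover have "str_code (inv str_code c) = c" for c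
    using bij_str_code by (simp add: bij_is_surj surj_f_inv_f)
  ultimately show "Sigma_pred 1 2 (\<lambda>xs. W (xs ! 0) (inv str_code (xs ! 1)))"
    by (auto simp: numeral_2_eq_2 numeral_3_eq_3 V(2) intro!: exI[of _ "\<lambda>xs. V (xs ! 0) (xs ! 1) (xs ! 2)"])
qed


lemma dec_pred_imp_Sigma1_str:
  assumes "dec_pred (\<lambda>_. False) (\<lambda>v. V (v 0))" and "\<And>\<sigma>. W \<sigma> \<longleftrightarrow> V (str_code \<sigma>)"
  shows "Sigma_pred 1 1 (\<lambda>xs. W (inv str_code (xs ! 0)))"
proof -
  have "dec_pred (\<lambda>_. False) (\<lambda>v. V (v 1))" by (rule dec_pred_lift1[OF assms(1) rec_fun_var])
  then show ?thesis unfolding Sigma1_str_iff[of W] using assms(2) by (intro exI[of _ "\<lambda>_. V"]) simp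
qed

lemma dec_pred_imp_Sigma1_nat_str:
  assumes "dec_pred (\<lambda>_. False) (\<lambda>v. V (v 0) (v 1))" and "\<And>i \<sigma>. W i \<sigma> \<longleftrightarrow> V i (str_code \<sigma>)"
  shows "Sigma_pred 1 2 (\<lambda>xs. W (xs ! 0) (inv str_code (xs ! 1)))"
proof -
  have "dec_pred (\<lambda>_. False) (\<lambda>v. V (v 1) (v 2))"
    by (rule dec_pred_lift2[OF assms(1) rec_fun_var rec_fun_var])
  then show ?thesis
    unfolding Sigma1_nat_str_iff[of W] using assms(2) by (intro exI[of _ "\<lambda>_. V"]) simp
qed


section \<open>Computations with bounded resources\<close>

text \<open>The value is \<open>Suc y\<close> if the result \<open>y\<close> is reached with \<open>Mu\<close>-searches and oracle queries confined to
  numbers below \<open>t\<close>, and \<open>0\<close> if there is no such result. The bits of \<open>b\<close> are the oracle.\<close>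

primrec sim :: "nat \<Rightarrow> nat \<Rightarrow> recf \<Rightarrow> nat list \<Rightarrow> nat" where
  "sim t b Zero = (\<lambda>xs. 1)"
| "sim t b Succ = (\<lambda>xs. case xs of [x] \<Rightarrow> Suc (Suc x) | _ \<Rightarrow> 0)"
| "sim t b Orc = (\<lambda>xs. case xs of [x] \<Rightarrow> if x < t then Suc (of_bool (bit b x)) else 0 | _ \<Rightarrow> 0)"
| "sim t b (Proj i) = (\<lambda>xs. if i < length xs then Suc (xs ! i) else 0)"
| "sim t b (Comp f gs) = (\<lambda>xs. if \<exists>h\<in>set (map (sim t b) gs). h xs = 0 then 0
     else sim t b f (map (\<lambda>h. h xs - 1) (map (sim t b) gs)))"
| "sim t b (PrimRec f g) = (\<lambda>xs. case xs of [] \<Rightarrow> 0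
     | n # ys \<Rightarrow> rec_nat (sim t b f ys) (\<lambda>m y. if y = 0 then 0 else sim t b g (m # (y - 1) # ys)) n)"
| "sim t b (Mu f) = (\<lambda>xs. if (LEAST n. n = t \<or> sim t b f (n # xs) \<le> 1) < t
       \<and> sim t b f ((LEAST n. n = t \<or> sim t b f (n # xs) \<le> 1) # xs) = 1
     then Suc (LEAST n. n = t \<or> sim t b f (n # xs) \<le> 1) else 0)"

text \<open>The \<open>LEAST\<close> in \<open>sim\<close> stops at the first value 0 (no result) or
  1 (result zero), or at the bound \<open>t\<close>; only the value 1 below \<open>t\<close> is a
  success. The resulting form mirrors the rule \<open>mu\<close>.\<close>

lemma sim_Mu_eq_Suc_iff:
  "sim t b (Mu f) xs = Suc n \<longleftrightarrow>
     n < t \<and> sim t b f (n # xs) = 1 \<and> (\<forall>m<n. \<exists>y>0. sim t b f (m # xs) = Suc y)"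
proof -
  let ?P = "\<lambda>n. n = t \<or> sim t b f (n # xs) \<le> 1"
  define k where "k = (LEAST n. ?P n)"
  have k: "?P k" unfolding k_def by (rule LeastI[of ?P t]) simp
  have below_k: "\<not> ?P m" if "m < k" for m using that unfolding k_def by (rule not_less_Least)
  have pos: "(\<exists>y>0. sim t b f (m # xs) = Suc y) \<longleftrightarrow> \<not> sim t b f (m # xs) \<le> 1" for m
    by (cases "sim t b f (m # xs)") auto
  have sim: "sim t b (Mu f) xs = (if k < t \<and> sim t b f (k # xs) = 1 then Suc k else 0)"
    by (simp add: k_def)
  show ?thesis
  proof
    assume "sim t b (Mu f) xs = Suc n"
    then have "n = k" "k < t" "sim t b f (k # xs) = 1" unfolding sim by (auto split: if_splits)
    then show "n < t \<and> sim t b f (n # xs) = 1 \<and> (\<forall>m<n. \<exists>y>0. sim t b f (m # xs) = Suc y)"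
      using below_k unfolding pos by blast
  next
    assume n: "n < t \<and> sim t b f (n # xs) = 1 \<and> (\<forall>m<n. \<exists>y>0. sim t b f (m # xs) = Suc y)"
    have "k = n" unfolding k_def
    proof (rule Least_equality)
      show "n \<le> m" if "?P m" for m
      proof (rule ccontr)
        assume "\<not> n \<le> m"
        then show False using n that unfolding pos by auto
      qed
    qed (use n in simp)
    then show "sim t b (Mu f) xs = Suc n" unfolding sim using n by simp
  qed
qed

text \<open>A bounded computation with a result has queried only positions below \<open>t\<close>,
  where the oracles agree, and a larger bound does not change completed searches.\<close>

lemma sim_mono:
  assumes "sim t b e xs = Suc y" and "t \<le> t'" and "\<And>i. i < t \<Longrightarrow> bit b' i = bit b i"
  shows "sim t' b' e xs = Suc y"
  using assms(1)
proof (induction e arbitrary: xs y)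
  case Orc
  then show ?case using assms(2,3) by (auto split: list.splits if_splits)
next
  case (Comp f gs)
  have pos: "\<forall>g\<in>set gs. sim t b g xs \<noteq> 0"
    and f: "sim t b f (map (\<lambda>g. sim t b g xs - 1) gs) = Suc y"
    using Comp.prems by (auto split: if_splits simp: comp_def)
  have eq: "sim t' b' g xs = sim t b g xs" if "g \<in> set gs" for g
    using Comp.IH(2)[OF that, of xs "sim t b g xs - 1"] pos that by simp
  show ?case using Comp.IH(1)[OF f] pos by (auto simp: comp_def eq cong: map_cong)
next
  case (PrimRec f g)
  then obtain n ys where xs: "xs = n # ys" by (cases xs) auto
  have "rec_nat (sim t b f ys) (\<lambda>m y. if y = 0 then 0 else sim t b g (m # (y - 1) # ys)) n = Suc y \<Longrightarrow>
      rec_nat (sim t' b' f ys) (\<lambda>m y. if y = 0 then 0 else sim t' b' g (m # (y - 1) # ys)) n = Suc y"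
  proof (induction n arbitrary: y)
    case 0
    then show ?case using PrimRec.IH(1) by simp
  next
    case (Suc n)
    then obtain z where z: "rec_nat (sim t b f ys)
        (\<lambda>m y. if y = 0 then 0 else sim t b g (m # (y - 1) # ys)) n = Suc z" "sim t b g (n # z # ys) = Suc y"
      by (cases "rec_nat (sim t b f ys) (\<lambda>m y. if y = 0 then 0 else sim t b g (m # (y - 1) # ys)) n") auto
    then show ?case using Suc.IH[OF z(1)] PrimRec.IH(2)[OF z(2)] by simp
  qed
  then show ?case using PrimRec.prems by (simp add: xs)
next
  case (Mu f)
  have n: "y < t" "sim t b f (y # xs) = 1" "\<And>m. m < y \<Longrightarrow> \<exists>z>0. sim t b f (m # xs) = Suc z"
    using Mu.prems unfolding sim_Mu_eq_Suc_iff by blast+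
  have "sim t' b' f (y # xs) = 1" using Mu.IH n(2) by simp
  moreover have "\<exists>z>0. sim t' b' f (m # xs) = Suc z" if "m < y" for m using n(3)[OF that] Mu.IH by blast
  ultimately show ?case unfolding sim_Mu_eq_Suc_iff using n(1) assms(2) by simp
qed (auto split: list.splits if_splits)

text \<open>A halting computation involves finitely many queries and searches, hence finitely many
  conditions that hold for all large \<open>t\<close>.\<close>

lemma eventually_sim:
  assumes "evals A e xs y"
  shows "\<forall>\<^sub>F t in sequentially. sim t (enc A t) e xs = Suc y"
  using assms
proof (induction rule: evals.induct)
  case (orc x)
  show ?case using eventually_gt_at_top[of x] by eventually_elim (simp add: bit_enc)
next
  case (comp ys gs xs f z)
  have "\<forall>\<^sub>F t in sequentially. \<forall>i\<in>{..<length gs}. sim t (enc A t) (gs ! i) xs = Suc (ys ! i)"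
    using comp by (intro eventually_ball_finite) auto
  then show ?case using comp.IH(2)
  proof eventually_elim
    case (elim t)
    have "map (\<lambda>g. sim t (enc A t) g xs - 1) gs = ys"
      using elim(1) comp.hyps by (intro nth_equalityI) auto
    moreover have "\<forall>g\<in>set gs. sim t (enc A t) g xs \<noteq> 0"
      using elim(1) by (auto simp: in_set_conv_nth)
    ultimately show ?case using elim(2) by (auto simp: comp_def)
  qed
next
  case (primrec_Suc f g n xs y z)
  show ?case using primrec_Suc.IH by eventually_elim simp
next
  case (mu f n xs)
  have "\<forall>\<^sub>F t in sequentially. \<forall>m\<in>{..<n}. \<exists>y>0. sim t (enc A t) f (m # xs) = Suc y"
  proof (rule eventually_ball_finite)
    show "\<forall>m\<in>{..<n}. \<forall>\<^sub>F t in sequentially. \<exists>y>0. sim t (enc A t) f (m # xs) = Suc y"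
    proof
      fix m assume "m \<in> {..<n}"
      then obtain y where "y > 0" "\<forall>\<^sub>F t in sequentially. sim t (enc A t) f (m # xs) = Suc y"
        using mu.IH(2) by blast
      then show "\<forall>\<^sub>F t in sequentially. \<exists>y>0. sim t (enc A t) f (m # xs) = Suc y"
        by (auto elim: eventually_mono)
    qed
  qed simp
  then show ?case using mu.IH(1) eventually_gt_at_top[of n]
    by eventually_elim (simp add: sim_Mu_eq_Suc_iff del: sim.simps)
qed auto

lemma turing_le_sim:
  assumes "X \<le>\<^sub>T Y"
  shows "\<exists>e. \<forall>n. \<forall>\<^sub>F t in sequentially. sim t (enc Y t) e [n] = Suc (of_bool (X n))"
  using assms eventually_sim unfolding turing_le_def by blast

lemma rec_fun_shift: "rec_fun A f \<Longrightarrow> rec_fun A (\<lambda>w. f (\<lambda>i. w (Suc i)))"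
  using rec_fun_compose[of A f "\<lambda>i w. w (Suc i)"] rec_fun_var by blast

lemma dec_pred_bex_list:
  assumes "\<And>x. x \<in> set xs \<Longrightarrow> dec_pred A (P x)"
  shows "dec_pred A (\<lambda>v. \<exists>x\<in>set xs. P x v)"
  using assms
proof (induction xs)
  case Nil
  show ?case using dec_pred_const[of A False] by simp
next
  case (Cons x xs)
  then have "dec_pred A (\<lambda>v. P x v \<or> (\<exists>x\<in>set xs. P x v))" by (intro rec_intros) auto
  then show ?case by simp
qed

text \<open>The code \<open>e\<close> is fixed and the induction follows its structure. Bound,
  oracle and arguments are functions of the environment because the \<open>PrimRec\<close> and
  \<open>Mu\<close> cases bind variables and shift it.\<close>

lemma rec_fun_sim:
  assumes "rec_fun A t" "rec_fun A b" "\<And>h. h \<in> set hs \<Longrightarrow> rec_fun A h"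
  shows "rec_fun A (\<lambda>v. sim (t v) (b v) e (map (\<lambda>h. h v) hs))"
  using assms
proof (induction e arbitrary: t b hs)
  case Zero
  show ?case by (simp add: rec_fun_const)
next
  case Succ
  show ?case
  proof (cases "\<exists>h. hs = [h]")
    case True
    then obtain h where hs: "hs = [h]" by blast
    then have "rec_fun A (\<lambda>v. Suc (Suc (h v)))" using Succ by (intro rec_intros) auto
    then show ?thesis by (simp add: hs)
  next
    case False
    then have "(case map (\<lambda>h. h v) hs of [x] \<Rightarrow> f x | _ \<Rightarrow> 0) = 0" for f :: "nat \<Rightarrow> nat" and v
      by (auto split: list.split)
    then show ?thesis by (simp add: rec_fun_const)
  qed
next
  case Orc
  show ?case
  proof (cases "\<exists>h. hs = [h]")
    case True
    then obtain h where hs: "hs = [h]" by blast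
    then have "rec_fun A (\<lambda>v. if h v < t v then Suc (of_bool (bit (b v) (h v))) else 0)"
      using Orc by (intro rec_intros) auto
    then show ?thesis by (simp add: hs)
  next
    case False
    then have "(case map (\<lambda>h. h v) hs of [x] \<Rightarrow> f x | _ \<Rightarrow> 0) = 0" for f :: "nat \<Rightarrow> nat" and v
      by (auto split: list.split)
    then show ?thesis by (simp add: rec_fun_const)
  qed
next
  case (Proj i)
  show ?case
  proof (cases "i < length hs")
    case True
    then have "rec_fun A (\<lambda>v. Suc ((hs ! i) v))" using Proj by (intro rec_intros) auto
    then show ?thesis using True by simp
  qed (simp add: rec_fun_const)
next
  case (Comp f gs)
  have g: "rec_fun A (\<lambda>v. sim (t v) (b v) g (map (\<lambda>h. h v) hs))" if "g \<in> set gs" for g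
    using Comp.IH(2)[OF that Comp.prems] .
  let ?G = "map (\<lambda>g v. sim (t v) (b v) g (map (\<lambda>h. h v) hs) - 1) gs"
  have "rec_fun A (\<lambda>v. if \<exists>g\<in>set gs. sim (t v) (b v) g (map (\<lambda>h. h v) hs) = 0 then 0
      else sim (t v) (b v) f (map (\<lambda>h. h v) ?G))"
    by (intro rec_intros dec_pred_bex_list g Comp.IH(1) Comp.prems(1,2)) (auto intro!: rec_intros g)
  then show ?case by (simp add: comp_def cong: if_cong)
next
  case (PrimRec f g)
  show ?case
  proof (cases hs)
    case Nil
    then show ?thesis by (simp add: rec_fun_const)
  next
    case (Cons n hs')
    have hs': "rec_fun A h" if "h \<in> set hs'" for h using PrimRec.prems(3) that by (simp add: Cons)
    let ?H = "(\<lambda>w. w 0) # (\<lambda>w. w 1 - 1) # map (\<lambda>h w. h (\<lambda>i. w (Suc (Suc i)))) hs'"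
    have shift: "rec_fun A h \<Longrightarrow> rec_fun A (\<lambda>w. h (\<lambda>i. w (Suc (Suc i))))" for h
      using rec_fun_compose[of A h "\<lambda>i w. w (Suc (Suc i))"] rec_fun_var by blast
    have "rec_fun A (\<lambda>w. sim (t (\<lambda>i. w (Suc (Suc i)))) (b (\<lambda>i. w (Suc (Suc i)))) g (map (\<lambda>h. h w) ?H))"
    proof (intro PrimRec.IH(2) shift PrimRec.prems(1,2))
      have "rec_fun A (\<lambda>w. w 0)" "rec_fun A (\<lambda>w. w 1 - 1)" by (intro rec_intros)+
      then show "rec_fun A h" if "h \<in> set ?H" for h using that shift hs' by auto
    qed
    then have step: "rec_fun A (\<lambda>w. sim (t (\<lambda>i. w (Suc (Suc i)))) (b (\<lambda>i. w (Suc (Suc i)))) g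
        (w 0 # (w 1 - 1) # map (\<lambda>h. h (\<lambda>i. w (Suc (Suc i)))) hs'))" by (simp add: comp_def)
    have n: "rec_fun A n" using PrimRec.prems(3) by (simp add: Cons)
    have "rec_fun A (\<lambda>v. rec_nat (sim (t v) (b v) f (map (\<lambda>h. h v) hs'))
        (\<lambda>m y. if y = 0 then 0 else sim (t v) (b v) g (m # (y - 1) # map (\<lambda>h. h v) hs')) (n v))"
      by (intro rec_intros step n PrimRec.IH(1) PrimRec.prems(1,2)) (rule hs')
    then show ?thesis by (simp add: Cons)
  qed
next
  case (Mu f)
  let ?H = "(\<lambda>w. w 0) # map (\<lambda>h w. h (\<lambda>i. w (Suc i))) hs"
  have "rec_fun A (\<lambda>w. sim (t (\<lambda>i. w (Suc i))) (b (\<lambda>i. w (Suc i))) f (map (\<lambda>h. h w) ?H))"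
    using Mu.prems by (intro Mu.IH rec_fun_shift) (auto intro!: rec_intros rec_fun_shift)
  then have sim: "rec_fun A (\<lambda>w. sim (t (\<lambda>i. w (Suc i))) (b (\<lambda>i. w (Suc i))) f
      (w 0 # map (\<lambda>h. h (\<lambda>i. w (Suc i))) hs))" by (simp add: comp_def)
  define n where "n v = (LEAST n. n = t v \<or> sim (t v) (b v) f (n # map (\<lambda>h. h v) hs) \<le> 1)" for v
  have n: "rec_fun A n"
    unfolding n_def by (intro rec_fun_Least rec_intros sim rec_fun_shift Mu.prems(1)) blast
  have "rec_fun A (\<lambda>v. sim (t v) (b v) f (map (\<lambda>h. h v) (n # hs)))"
    using n Mu.prems by (intro Mu.IH) auto
  then have "rec_fun A (\<lambda>v. if n v < t v \<and> sim (t v) (b v) f (n v # map (\<lambda>h. h v) hs) = 1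
      then Suc (n v) else 0)"
    using n Mu.prems(1) by (intro rec_intros) auto
  then show ?case by (simp add: n_def cong: if_cong)
qed


section \<open>Computable approximations\<close>

definition limit_computes :: "(nat \<Rightarrow> nat \<Rightarrow> bool) \<Rightarrow> (nat \<Rightarrow> bool) \<Rightarrow> bool" where
  "limit_computes g X \<longleftrightarrow> dec_pred (\<lambda>_. False) (\<lambda>v. g (v 0) (v 1)) \<and>
     (\<forall>n. \<forall>\<^sub>F t in sequentially. g t n = X n)"

lemma Sigma2_imp_dec_pred:
  assumes "Sigma_pred 2 1 (\<lambda>xs. X (xs ! 0))"
  shows "\<exists>S. dec_pred (\<lambda>_. False) (\<lambda>v. S (v 0) (v 1) (v 2)) \<and> (\<forall>n. X n \<longleftrightarrow> (\<exists>a. \<forall>b. S b a n))"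
proof -
  have "Sigma_pred (Suc (Suc 0)) 1 (\<lambda>xs. X (xs ! 0))" using assms by (simp only: numeral_2_eq_2)
  then obtain Q where Q: "Sigma_pred (Suc 0) 2 (\<lambda>xs. \<not> Q xs)"
    "\<forall>xs. length xs = 1 \<longrightarrow> X (xs ! 0) \<longleftrightarrow> (\<exists>a. Q (a # xs))"
    unfolding Sigma_pred.simps(2)[of "Suc 0"] by (auto simp del: Sigma_pred.simps simp: numeral_2_eq_2)
  from Q(1) obtain Q' where Q': "computable 3 (\<lambda>xs. of_bool (\<not> Q' xs))"
    "\<forall>xs. length xs = 2 \<longrightarrow> (\<not> Q xs) \<longleftrightarrow> (\<exists>b. Q' (b # xs))"
    unfolding Sigma_pred.simps by (auto simp: numeral_3_eq_3 numeral_2_eq_2)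
  have "dec_pred (\<lambda>_. False) (\<lambda>v. \<not> Q' [v 0, v 1, v 2])"
    using Q'(1) unfolding computable_of_bool_iff by (simp add: numeral_2_eq_2 numeral_3_eq_3)
  moreover have "X n \<longleftrightarrow> (\<exists>a. \<forall>b. \<not> Q' [b, a, n])" for n
    using Q(2)[rule_format, of "[n]"] Q'(2)[rule_format, of "[_, n]"] by auto
  ultimately show ?thesis by (intro exI[of _ "\<lambda>b a n. \<not> Q' [b, a, n]"]) simp
qed

text \<open>This is the limit lemma. Stage \<open>t\<close> adopts the least candidate witness, for
  membership or for non-membership, that \<open>t\<close> tests have not refuted. The least true
  witness is never refuted, and each smaller candidate eventually is.\<close>

lemma Delta02_limit_computes:
  assumes "Delta02 X"
  shows "\<exists>g. limit_computes g X"
proof -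
  have Sigma: "Sigma_pred 2 1 (\<lambda>xs. X (xs ! 0))" "Sigma_pred 2 1 (\<lambda>xs. \<not> X (xs ! 0))"
    using assms unfolding Delta02_def Pi_pred_def by auto
  from Sigma2_imp_dec_pred[OF Sigma(1)] obtain S where
    S: "dec_pred (\<lambda>_. False) (\<lambda>v. S (v 0) (v 1) (v 2))" "\<And>n. X n \<longleftrightarrow> (\<exists>a. \<forall>b. S b a n)"
    by (elim exE conjE) simp
  from Sigma2_imp_dec_pred[of "\<lambda>n. \<not> X n", OF Sigma(2)] obtain S' where
    S': "dec_pred (\<lambda>_. False) (\<lambda>v. S' (v 0) (v 1) (v 2))" "\<And>n. \<not> X n \<longleftrightarrow> (\<exists>a. \<forall>b. S' b a n)"
    by (elim exE conjE) simp
  \<comment> \<open>The disjunct \<open>a = t\<close> lets the search for a candidate terminate at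
    every stage.\<close>
  define P where "P a t n \<longleftrightarrow> a = t \<or> (\<forall>b<t. S b a n) \<or> (\<forall>b<t. S' b a n)" for a t n
  define g where "g t n \<longleftrightarrow> (\<forall>b<t. S b (LEAST a. P a t n) n)" for t n
  have "rec_fun (\<lambda>_. False) (\<lambda>v. LEAST a. P a (v 0) (v 1))"
    unfolding P_def by (intro rec_fun_Least rec_intros dec_pred_lift3[OF S(1)] dec_pred_lift3[OF S'(1)]) blast
  from rec_fun_shift[OF this] have "dec_pred (\<lambda>_. False) (\<lambda>v. g (v 0) (v 1))"
    unfolding g_def by (intro rec_intros dec_pred_lift3[OF S(1)])
  moreover have "\<forall>\<^sub>F t in sequentially. g t n = X n" for n
  proof -
    define a where "a = (LEAST a. (\<forall>b. S b a n) \<or> (\<forall>b. S' b a n))"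
    have ex: "\<exists>a. (\<forall>b. S b a n) \<or> (\<forall>b. S' b a n)" using S(2) S'(2) by blast
    have a: "(\<forall>b. S b a n) \<or> (\<forall>b. S' b a n)" unfolding a_def by (rule LeastI_ex[OF ex])
    have refuted: "\<forall>\<^sub>F t in sequentially. \<not> (\<forall>b<t. T b c n)" if T: "\<not> (\<forall>b. T b c n)"
      for T :: "nat \<Rightarrow> nat \<Rightarrow> nat \<Rightarrow> bool" and c
    proof -
      obtain b where b: "\<not> T b c n" using T by blast
      show ?thesis using eventually_gt_at_top[of b] by eventually_elim (use b in blast)
    qed
    have "\<forall>\<^sub>F t in sequentially. \<forall>c\<in>{..<a}. \<not> (\<forall>b<t. S b c n) \<and> \<not> (\<forall>b<t. S' b c n)"
    proof (rule eventually_ball_finite)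
      show "\<forall>c\<in>{..<a}. \<forall>\<^sub>F t in sequentially. \<not> (\<forall>b<t. S b c n) \<and> \<not> (\<forall>b<t. S' b c n)"
      proof
        fix c assume "c \<in> {..<a}"
        then have "\<not> (\<forall>b. S b c n)" "\<not> (\<forall>b. S' b c n)" using not_less_Least unfolding a_def by blast+
        then show "\<forall>\<^sub>F t in sequentially. \<not> (\<forall>b<t. S b c n) \<and> \<not> (\<forall>b<t. S' b c n)"
          using refuted[of S c] refuted[of S' c] by (simp add: eventually_conj)
      qed
    qed simp
    then have least: "\<forall>\<^sub>F t in sequentially. (LEAST a. P a t n) = a" using eventually_gt_at_top[of a]
    proof eventually_elim
      case (elim t)
      show ?case
      proof (rule Least_equality)
        show "P a t n" using a by (auto simp: P_def)
        show "a \<le> c" if "P c t n" for c using that elim by (auto simp: P_def not_less[symmetric])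
      qed
    qed
    show ?thesis
    proof (cases "X n")
      case True
      then have "\<not> (\<forall>b. S' b a n)" using S'(2) by blast
      then have "\<forall>b. S b a n" using a by blast
      then show ?thesis using least True by (auto simp: g_def elim: eventually_mono)
    next
      case False
      then have "\<not> (\<forall>b. S b a n)" using S(2) by blast
      from least refuted[of S a, OF this] show ?thesis
        by eventually_elim (simp add: g_def False)
    qed
  qed
  ultimately show ?thesis unfolding limit_computes_def by blast
qed

text \<open>The reduction is simulated with the approximation as oracle. One halting run uses a
  finite part of \<open>X\<close>, on which the approximation is eventually correct.\<close>

lemma limit_computes_turing_le:
  assumes "limit_computes g X" and "Y \<le>\<^sub>T X"
  shows "\<exists>h. limit_computes h Y"
proof -
  obtain e where e: "\<And>n. \<forall>\<^sub>F t in sequentially. sim t (enc X t) e [n] = Suc (of_bool (Y n))"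
    using turing_le_sim[OF assms(2)] by blast
  \<comment> \<open>The value 2 is \<open>Suc\<close> of the output 1.\<close>
  define h where "h t n \<longleftrightarrow> sim t (enc (g t) t) e [n] = 2" for t n
  have g: "dec_pred (\<lambda>_. False) (\<lambda>v. g (v 0) (v 1))" using assms(1) by (simp add: limit_computes_def)
  have "rec_fun (\<lambda>_. False) (\<lambda>v. sim (v 0) (enc (g (v 0)) (v 0)) e (map (\<lambda>h. h v) [\<lambda>v. v 1]))"
    by (intro rec_fun_sim rec_intros dec_pred_lift2[OF g]) (auto intro: rec_intros)
  then have "dec_pred (\<lambda>_. False) (\<lambda>v. h (v 0) (v 1))"
    unfolding h_def by (intro rec_intros) auto
  moreover have "\<forall>\<^sub>F t in sequentially. h t n = Y n" for n
  proof -
    obtain s where s: "sim s (enc X s) e [n] = Suc (of_bool (Y n))"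
      using eventually_happens[OF e[of n]] by auto
    have "\<forall>\<^sub>F t in sequentially. \<forall>i\<in>{..<s}. g t i = X i"
      using assms(1) by (intro eventually_ball_finite) (auto simp: limit_computes_def)
    then show ?thesis using eventually_ge_at_top[of s]
    proof eventually_elim
      case (elim t)
      have "sim t (enc (g t) t) e [n] = Suc (of_bool (Y n))"
        using sim_mono[OF s elim(2), of "enc (g t) t"] elim by (simp add: bit_enc)
      then show ?case by (simp add: h_def)
    qed
  qed
  ultimately show ?thesis unfolding limit_computes_def by blast
qed


section \<open>Topology of Cantor space\<close>

lemma ex_cylinder_subset:
  assumes "open U" and "X \<in> U"
  shows "\<exists>l. cylinder (restr X l) \<subseteq> U"
proof -
  from product_topology_open_contains_basis[OF assms(1)[unfolded open_fun_def] assms(2)]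
  obtain V where "X \<in> Pi\<^sub>E UNIV V \<and> (\<forall>i. openin euclidean (V i)) \<and>
      finite {i. V i \<noteq> topspace (euclidean :: bool topology)} \<and> Pi\<^sub>E UNIV V \<subseteq> U" ..
  then have V: "X \<in> Pi\<^sub>E UNIV V" "finite {i. V i \<noteq> UNIV}" "Pi\<^sub>E UNIV V \<subseteq> U"
    by simp_all
  obtain l where l: "\<And>i. V i \<noteq> UNIV \<Longrightarrow> i < l"
    using V(2) unfolding finite_nat_set_iff_bounded by auto
  have "cylinder (restr X l) \<subseteq> Pi\<^sub>E UNIV V"
  proof
    fix Y assume "Y \<in> cylinder (restr X l)"
    then have "\<forall>i<l. Y i = X i" by (simp add: cylinder_def)
    then have "Y i \<in> V i" for i using V(1) l[of i] by (cases "i < l") (auto simp: PiE_iff)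
    then show "Y \<in> Pi\<^sub>E UNIV V" by (simp add: PiE_iff)
  qed
  then show ?thesis using V(3) by blast
qed

lemma singleton_in_borel: "{X :: nat \<Rightarrow> bool} \<in> sets borel"
proof -
  have "{X} = (\<Inter>l. cylinder (restr X l))"
    by (auto simp: cylinder_def)
  moreover have "\<dots> \<in> sets borel"
    by (intro sets.countable_INT') (auto intro!: borel_open open_cylinder)
  ultimately show ?thesis by simp
qed

lemma isolated_in_cantor_iff:
  fixes X :: "nat \<Rightarrow> bool"
  shows "X isolated_in S \<longleftrightarrow> X \<in> S \<and> (\<exists>l. \<forall>Y\<in>S. (\<forall>i<l. Y i = X i) \<longrightarrow> Y = X)"
proof
  assume "X isolated_in S"
  then obtain U where U: "X \<in> S" "open U" "U \<inter> S = {X}" by (auto simp: isolated_in_def)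
  then obtain l where "cylinder (restr X l) \<subseteq> U" using ex_cylinder_subset[of U X] by blast
  then have "\<forall>Y\<in>S. (\<forall>i<l. Y i = X i) \<longrightarrow> Y = X" using U(3) by (auto simp: cylinder_def)
  then show "X \<in> S \<and> (\<exists>l. \<forall>Y\<in>S. (\<forall>i<l. Y i = X i) \<longrightarrow> Y = X)" using U(1) by blast
next
  assume "X \<in> S \<and> (\<exists>l. \<forall>Y\<in>S. (\<forall>i<l. Y i = X i) \<longrightarrow> Y = X)"
  then obtain l where l: "X \<in> S" "\<forall>Y\<in>S. (\<forall>i<l. Y i = X i) \<longrightarrow> Y = X" by blast
  then have "cylinder (restr X l) \<inter> S = {X}" by (auto simp: cylinder_def)
  then show "X isolated_in S" using l(1) open_cylinder unfolding isolated_in_def by blast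
qed

text \<open>The path is built greedily, preferring \<open>True\<close>, through strings with
  extensions in the tree at every level (\<open>ext\<close>). If both one-bit extensions failed, an
  extension at the larger of the two failing levels would give a contradiction.\<close>

lemma konig:
  assumes ex: "\<And>l. \<exists>X. T (restr X l)"
    and mono: "\<And>X k l. k \<le> l \<Longrightarrow> T (restr X l) \<Longrightarrow> T (restr X k)"
  shows "\<exists>X. \<forall>l. T (restr X l)"
proof -
  define ext where "ext \<sigma> \<longleftrightarrow> (\<forall>l. \<exists>X. restr X (length \<sigma>) = \<sigma> \<and> T (restr X l))" for \<sigma>
  have step: "ext (\<sigma> @ [True]) \<or> ext (\<sigma> @ [False])" if \<sigma>: "ext \<sigma>" for \<sigma>
  proof (rule ccontr)
    assume "\<not> (ext (\<sigma> @ [True]) \<or> ext (\<sigma> @ [False]))"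
    then obtain k l where k: "\<And>X. restr X (Suc (length \<sigma>)) = \<sigma> @ [True] \<Longrightarrow> \<not> T (restr X k)"
      and l: "\<And>X. restr X (Suc (length \<sigma>)) = \<sigma> @ [False] \<Longrightarrow> \<not> T (restr X l)"
      unfolding ext_def by auto
    obtain X where X: "restr X (length \<sigma>) = \<sigma>" "T (restr X (max k l))"
      using \<sigma> unfolding ext_def by blast
    have "restr X (Suc (length \<sigma>)) = \<sigma> @ [X (length \<sigma>)]"
      using X(1) by (simp add: restr_def)
    then show False using k[of X] l[of X] mono[OF _ X(2)] by (cases "X (length \<sigma>)") auto
  qed
  define s where "s = rec_nat [] (\<lambda>_ \<sigma>. \<sigma> @ [ext (\<sigma> @ [True])])"
  define X where "X n = ext (s n @ [True])" for n
  have s: "restr X n = s n" for n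
    by (induction n) (simp_all add: s_def X_def restr_def)
  have "ext (s n)" for n
  proof (induction n)
    case 0
    show ?case using ex by (simp add: s_def ext_def restr_def)
  next
    case (Suc n)
    have "s (Suc n) = s n @ [ext (s n @ [True])]" by (simp add: s_def)
    then show ?case using step[OF Suc] by (cases "ext (s n @ [True])") auto
  qed
  then have "\<exists>Y. restr Y n = s n \<and> T (restr Y n)" for n
    using s[of n] length_restr[of X n] unfolding ext_def by metis
  then have "T (restr X n)" for n using s by metis
  then show ?thesis by blast
qed

text \<open>A \<open>\<Pi>\<^sup>0\<^sub>1\<close> class is the set of paths through a decidable tree: \<open>\<sigma>\<close> is cut off once a prefix of
  \<open>\<sigma>\<close> has been enumerated within \<open>length \<sigma>\<close> stages.\<close>

lemma Pi01_class_tree: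
  assumes "Pi01_class Q"
  shows "\<exists>T. dec_pred (\<lambda>_. False) (\<lambda>v. T (restr (bit (v 1)) (v 0))) \<and>
    (\<forall>X k l. k \<le> l \<longrightarrow> T (restr X l) \<longrightarrow> T (restr X k)) \<and> Q = {X. \<forall>l. T (restr X l)}"
proof -
  obtain W where W: "Sigma_pred 1 1 (\<lambda>xs. W (inv str_code (xs ! 0)))"
    "Q = - (\<Union>\<sigma>\<in>{\<sigma>. W \<sigma>}. cylinder \<sigma>)"
    using assms unfolding Pi01_class_def by blast
  obtain V where V: "dec_pred (\<lambda>_. False) (\<lambda>v. V (v 0) (v 1))" "\<And>\<sigma>. W \<sigma> \<longleftrightarrow> (\<exists>a. V a (str_code \<sigma>))"
    using W(1) unfolding Sigma1_str_iff by blast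
  define T where "T \<sigma> \<longleftrightarrow> (\<forall>j\<le>length \<sigma>. \<forall>a\<le>length \<sigma>. \<not> V a (str_code (restr ((!) \<sigma>) j)))" for \<sigma>
  have prefix: "restr ((!) (restr X l)) j = restr X j" if "j \<le> l" for X j l
    using that by (simp add: restr_eq_iff)
  have T: "T (restr X l) \<longleftrightarrow> (\<forall>j\<le>l. \<forall>a\<le>l. \<not> V a (str_code (restr X j)))" for X l
    by (simp add: T_def prefix)
  have "dec_pred (\<lambda>_. False) (\<lambda>v. T (restr (bit (v 1)) (v 0)))"
    unfolding T str_code_restr by (intro rec_intros dec_pred_lift2[OF V(1)])
  moreover have "T (restr X k)" if "k \<le> l" "T (restr X l)" for X k l
    using that unfolding T by force
  moreover have "X \<in> Q \<longleftrightarrow> (\<forall>l. T (restr X l))" for X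
  proof -
    have "X \<in> Q \<longleftrightarrow> (\<forall>j. \<not> W (restr X j))"
      unfolding W(2) by (auto simp: mem_cylinder_iff) (metis mem_Collect_eq)
    also have "\<dots> \<longleftrightarrow> (\<forall>j a. \<not> V a (str_code (restr X j)))" using V(2) by blast
    also have "\<dots> \<longleftrightarrow> (\<forall>l. T (restr X l))"
      unfolding T by (metis max.cobounded1 max.cobounded2)
    finally show ?thesis .
  qed
  ultimately show ?thesis by blast
qed

text \<open>The oracle supplies the values of \<open>X\<close> on \<open>q\<close>. By compactness every other value is decided
  at some level of the tree.\<close>

lemma isolated_fibre_turing_le:
  assumes "Pi01_class Q" and q: "dec_pred (\<lambda>_. False) (\<lambda>v. q (v 0))"
    and iso: "X isolated_in {Y \<in> Q. \<forall>m. q m \<longrightarrow> Y m = X m}"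
  shows "X \<le>\<^sub>T (\<lambda>m. q m \<and> X m)"
proof -
  define B where "B m \<longleftrightarrow> q m \<and> X m" for m
  obtain T where T: "dec_pred (\<lambda>_. False) (\<lambda>v. T (restr (bit (v 1)) (v 0)))"
    "\<And>X k l. k \<le> l \<Longrightarrow> T (restr X l) \<Longrightarrow> T (restr X k)" "Q = {X. \<forall>l. T (restr X l)}"
    using Pi01_class_tree[OF assms(1)] by blast
  obtain l0 where "X \<in> Q" and l0: "\<And>Y. Y \<in> Q \<Longrightarrow> \<forall>m. q m \<longrightarrow> Y m = X m \<Longrightarrow> \<forall>i<l0. Y i = X i \<Longrightarrow> Y = X"
    using iso unfolding isolated_in_cantor_iff by blast
  \<comment> \<open>Candidates at level \<open>l\<close> lie in the tree, agree with the oracle on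
    \<open>q\<close>, and agree with \<open>X\<close> below \<open>l0\<close>. The last condition is
    finite information, hard-wired as the number \<open>enc X l0\<close>.\<close>
  define C where "C Y l \<longleftrightarrow> T (restr Y l) \<and> (\<forall>i<l. (q i \<longrightarrow> Y i = B i) \<and> (i < l0 \<longrightarrow> Y i = bit (enc X l0) i))" for Y l
  have C_X: "C X l" for l using \<open>X \<in> Q\<close> by (auto simp: C_def B_def T(3) bit_enc)
  \<comment> \<open>\<open>w\<close> packs the level \<open>w div 2\<close> and the bit
    \<open>odd w\<close>, so that a single search finds a level at which all candidates have the
    same bit at \<open>m\<close>, together with that bit.\<close>
  define D where "D m w \<longleftrightarrow> m < w div 2 \<and> (\<forall>b :: nat<2 ^ (w div 2). C (bit b) (w div 2) \<longrightarrow> bit b m = odd w)" for m w :: nat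
  have sound: "X m = odd w" if "D m w" for m w
  proof -
    let ?b = "enc X (w div 2)"
    have "restr (bit ?b) (w div 2) = restr X (w div 2)" by (simp add: restr_eq_iff bit_enc)
    then have "C (bit ?b) (w div 2)" using C_X[of "w div 2"] by (simp add: C_def bit_enc)
    then have "bit ?b m = odd w" using that enc_less[of X "w div 2"] by (simp add: D_def)
    then show ?thesis using that by (simp add: D_def bit_enc)
  qed
  have ex: "\<exists>w. D m w" for m
  proof (rule ccontr)
    assume none: "\<nexists>w. D m w"
    \<comment> \<open>These are the candidates that differ from \<open>X\<close> at
      \<open>m\<close>. If no level decided \<open>m\<close>, their tree would be infinite, and a
      path through it would be a second point of the fibre in the isolating neighbourhood.\<close>
    define S where "S \<sigma> \<longleftrightarrow> T \<sigma> \<and> (\<forall>i<length \<sigma>. (q i \<longrightarrow> \<sigma> ! i = B i) \<and> (i < l0 \<longrightarrow> \<sigma> ! i = bit (enc X l0) i)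
      \<and> (i = m \<longrightarrow> \<sigma> ! i \<noteq> X i))" for \<sigma>
    have S: "S (restr Y l) \<longleftrightarrow> C Y l \<and> (m < l \<longrightarrow> Y m \<noteq> X m)" for Y l by (auto simp: S_def C_def)
    have mono: "S (restr Y k)" if "k \<le> l" "S (restr Y l)" for Y k l
      using that T(2)[of k l Y] unfolding S by (auto simp: C_def)
    have "\<exists>Y. \<forall>l. S (restr Y l)"
    proof (rule konig)
      show "S (restr Y k)" if "k \<le> l" "S (restr Y l)" for Y k l using that by (rule mono)
    next
      fix l
      define L where "L = max l (Suc m)"
      have "\<not> D m (2 * L + of_bool (X m))" using none by blast
      then obtain b :: nat where "C (bit b) L" "bit b m \<noteq> X m" by (auto simp: D_def L_def)
      then have "S (restr (bit b) L)" by (simp add: S)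
      then show "\<exists>Y. S (restr Y l)" using mono[of l L] by (auto simp: L_def)
    qed
    then obtain Y where Y: "\<And>l. C Y l" "\<And>l. m < l \<Longrightarrow> Y m \<noteq> X m" unfolding S by blast
    have "Y = X"
    proof (rule l0)
      show "Y \<in> Q" using Y(1) by (simp add: T(3) C_def)
      show "\<forall>m. q m \<longrightarrow> Y m = X m" using Y(1) by (auto simp: C_def B_def)
      show "\<forall>i<l0. Y i = X i" using Y(1) by (auto simp: C_def bit_enc)
    qed
    then show False using Y(2)[of "Suc m"] by simp
  qed
  have "dec_pred B (\<lambda>w. D (w (Suc 0)) (w 0))"
    unfolding D_def C_def
    by (intro rec_intros dec_pred_lift2[OF T(1)[THEN dec_pred_any_oracle]]
        dec_pred_lift1[OF q[THEN dec_pred_any_oracle]] dec_pred_oracle)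
  then have "rec_fun B (\<lambda>v. LEAST w. D (v 0) w)" by (rule rec_fun_Least) (rule ex)
  then have "dec_pred B (\<lambda>v. (LEAST w. D (v 0) w) mod 2 = 1)" by (intro rec_intros)
  moreover have "(LEAST w. D m w) mod 2 = 1 \<longleftrightarrow> X m" for m
    using sound[OF LeastI_ex[OF ex[of m]]] by (simp add: odd_iff_mod_2_eq_one)
  ultimately show ?thesis by (simp add: turing_le_iff B_def[abs_def])
qed


section \<open>Lebesgue measure and randomness\<close>

interpretation lebesgue_cantor: prob_space lebesgue_cantor
  by (rule prob_space_lebesgue_cantor)

lemma space_lebesgue_cantor [simp]: "space lebesgue_cantor = UNIV"
  using sets_eq_imp_space_eq[OF sets_lebesgue_cantor] by simp

lemma cylinder_in_sets: "cylinder \<sigma> \<in> sets lebesgue_cantor"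
  by (simp add: sets_lebesgue_cantor borel_open open_cylinder)

lemma measure_lebesgue_cylinder: "measure lebesgue_cantor (cylinder \<sigma>) = (1/2) ^ length \<sigma>"
proof -
  let ?M = "\<lambda>_ :: nat. measure_pmf (bernoulli_pmf (1/2))"
  interpret product_prob_space ?M UNIV
    by (intro product_prob_spaceI) (rule measure_pmf.prob_space_axioms)
  have "cylinder \<sigma> = prod_emb UNIV ?M {..<length \<sigma>} (Pi\<^sub>E {..<length \<sigma>} (\<lambda>i. {\<sigma> ! i}))"
    by (rule set_eqI) (simp add: prod_emb_iff PiE_iff cylinder_def Ball_def)
  then have "measure lebesgue_cantor (cylinder \<sigma>)
      = (\<Prod>i<length \<sigma>. measure (measure_pmf (bernoulli_pmf (1/2))) {\<sigma> ! i})"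
    unfolding lebesgue_cantor_def by (simp only:) (rule measure_PiM_emb; simp)
  also have "\<dots> = (\<Prod>i<length \<sigma>. 1/2)"
  proof (rule prod.cong)
    fix i show "measure (measure_pmf (bernoulli_pmf (1/2))) {\<sigma> ! i} = 1/2"
      unfolding measure_pmf_single by (cases "\<sigma> ! i") auto
  qed simp
  finally show ?thesis by simp
qed

lemma prefix_event:
  assumes "\<And>X Y. restr X l = restr Y l \<Longrightarrow> P X \<Longrightarrow> P Y"
  shows "{X. P X} = (\<Union>b\<in>{b. b < 2 ^ l \<and> P (bit b)}. cylinder (restr (bit (b :: nat)) l))"
proof -
  have "\<exists>b :: nat<2 ^ l. P (bit b) \<and> X \<in> cylinder (restr (bit b) l)" if "P X" for X
  proof -
    have "restr X l = restr (bit (enc X l)) l" by (simp add: restr_eq_iff bit_enc)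
    then show ?thesis using assms[OF _ that] enc_less[of X l]
      by (intro exI[of _ "enc X l"]) (simp add: mem_cylinder_iff)
  qed
  moreover have "P X" if "P (bit b)" "X \<in> cylinder (restr (bit b) l)" for X and b :: nat
    using assms[OF _ that(1), of X] that(2) by (simp add: mem_cylinder_iff)
  ultimately show ?thesis by blast
qed

lemma
  assumes "\<And>X Y. restr X l = restr Y l \<Longrightarrow> P X \<Longrightarrow> P Y"
  shows sets_prefix_event: "{X. P X} \<in> sets lebesgue_cantor"
    and measure_prefix_event:
      "measure lebesgue_cantor {X. P X} = card {b :: nat. b < 2 ^ l \<and> P (bit b)} / 2 ^ l"
proof -
  have eq: "{X. P X} = (\<Union>b\<in>{b. b < 2 ^ l \<and> P (bit b)}. cylinder (restr (bit (b :: nat)) l))"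
    using assms by (rule prefix_event)
  have fin: "finite {b :: nat. b < 2 ^ l \<and> P (bit b)}" by simp
  show "{X. P X} \<in> sets lebesgue_cantor"
    by (subst eq) (intro sets.finite_UN fin cylinder_in_sets)
  have "disjoint_family_on (\<lambda>b :: nat. cylinder (restr (bit b) l)) {b. b < 2 ^ l \<and> P (bit b)}"
  unfolding disjoint_family_on_def
  proof (intro ballI impI)
    fix b c :: nat
    assume "b \<in> {b. b < 2 ^ l \<and> P (bit b)}" "c \<in> {b. b < 2 ^ l \<and> P (bit b)}" "b \<noteq> c"
    then have "enc (bit b) l \<noteq> enc (bit c) l" by (simp add: enc_bit)
    then have "restr (bit b) l \<noteq> restr (bit c) l" by (metis enc_def)
    then show "cylinder (restr (bit b) l) \<inter> cylinder (restr (bit c) l) = {}"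
      by (auto simp: mem_cylinder_iff)
  qed
  then have "measure lebesgue_cantor {X. P X}
      = (\<Sum>b\<in>{b :: nat. b < 2 ^ l \<and> P (bit b)}. measure lebesgue_cantor (cylinder (restr (bit b) l)))"
    by (subst eq) (intro lebesgue_cantor.finite_measure_finite_Union fin, auto simp: cylinder_in_sets)
  also have "\<dots> = real (card {b :: nat. b < 2 ^ l \<and> P (bit b)}) * (1/2) ^ l"
    unfolding measure_lebesgue_cylinder length_restr by (rule sum_constant)
  finally show "measure lebesgue_cantor {X. P X} = card {b :: nat. b < 2 ^ l \<and> P (bit b)} / 2 ^ l"
    unfolding power_one_over by simp
qed

text \<open>If the bits at the positions \<open>p k\<close> could be computed from the bits on \<open>q\<close>, then the first
  \<open>j\<close> of them would be determined by the other ones, which happens with probability \<open>2\<^sup>-\<^sup>j\<close>.\<close>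

lemma random_not_computed_from_other_bits:
  assumes random: "martin_lof_random lebesgue_cantor Z"
    and q: "dec_pred (\<lambda>_. False) (\<lambda>v. q (v 0))"
    and p: "rec_fun (\<lambda>_. False) (\<lambda>v. p (v 0))" "inj p" "\<And>k. \<not> q (p k)"
    and W: "W \<le>\<^sub>T (\<lambda>m. q m \<and> Z m)"
  shows "\<exists>k. W (p k) \<noteq> Z (p k)"
proof (rule ccontr)
  assume "\<nexists>k. W (p k) \<noteq> Z (p k)"
  then have WZ: "W (p k) = Z (p k)" for k by blast
  obtain e where e: "\<And>n. \<forall>\<^sub>F t in sequentially. sim t (enc (\<lambda>m. q m \<and> Z m) t) e [n] = Suc (of_bool (W n))"
    using turing_le_sim[OF W] by blast
  \<comment> \<open>Stage \<open>l\<close> of the test: the reduction, given the bits of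
    \<open>X\<close> on \<open>q\<close> below \<open>l\<close>, has returned the bits of
    \<open>X\<close> at the first \<open>j\<close> positions \<open>p k\<close>. As these lie below
    \<open>l\<close>, the condition depends only on the prefix of length \<open>l\<close>.\<close>
  define C where "C j l X \<longleftrightarrow> (\<forall>k<j. p k < l \<and> sim l (enc (\<lambda>m. q m \<and> X m) l) e [p k] = Suc (of_bool (X (p k))))" for j l X
  have cong: "C j l Y" if "restr X l = restr Y l" "C j l X" for j l X Y
  proof -
    have "enc (\<lambda>m. q m \<and> X m) l = enc (\<lambda>m. q m \<and> Y m) l"
      using that(1) by (intro enc_cong) (simp add: restr_eq_iff)
    then show ?thesis using that by (auto simp: C_def restr_eq_iff)
  qed
  have mono: "C j l' X" if "l \<le> l'" "C j l X" for j l l' X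
    using that(2) sim_mono[OF _ that(1), of "enc (\<lambda>m. q m \<and> X m) l" e _ _ "enc (\<lambda>m. q m \<and> X m) l'"] that(1)
    by (auto simp: C_def bit_enc)
  define U where "U j = {X. \<exists>l. C j l X}" for j
  have "uniformly_Sigma01 U"
    unfolding uniformly_Sigma01_def
  proof (intro exI conjI)
    let ?W = "\<lambda>j \<sigma>. C j (length \<sigma>) ((!) \<sigma>)"
    show "Sigma_pred 1 2 (\<lambda>xs. ?W (xs ! 0) (inv str_code (xs ! 1)))"
    proof (rule dec_pred_imp_Sigma1_nat_str[of "\<lambda>j c. C j (len_code c) (bit (Suc c))" ?W])
      have sim: "rec_fun (\<lambda>_. False) (\<lambda>v. sim (a v) (b v) e [c v])"
        if "rec_fun (\<lambda>_. False) a" "rec_fun (\<lambda>_. False) b" "rec_fun (\<lambda>_. False) c" for a b c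
        using rec_fun_sim[of _ a b "[c]"] that by simp
      show "dec_pred (\<lambda>_. False) (\<lambda>v. C (v 0) (len_code (v 1)) (bit (Suc (v 1))))"
        unfolding C_def by (intro rec_intros sim dec_pred_lift1[OF q] rec_fun_lift1[OF p(1)])
      fix j \<sigma>
      have eq: "restr ((!) \<sigma>) (length \<sigma>) = restr (bit (Suc (str_code \<sigma>))) (length \<sigma>)"
        by (simp add: restr_nth restr_bit_str_code)
      show "?W j \<sigma> \<longleftrightarrow> C j (len_code (str_code \<sigma>)) (bit (Suc (str_code \<sigma>)))"
        unfolding len_code_str_code by (rule iffI) (erule cong[OF eq], erule cong[OF eq[symmetric]])
    qed
    show "\<forall>j. U j = (\<Union>\<sigma>\<in>{\<sigma>. ?W j \<sigma>}. cylinder \<sigma>)"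
    proof (intro allI set_eqI iffI)
      fix j X assume "X \<in> U j"
      then obtain l where "C j l X" by (auto simp: U_def)
      then have "?W j (restr X l)" using cong[of X l "(!) (restr X l)"] by (simp add: restr_eq_iff)
      then show "X \<in> (\<Union>\<sigma>\<in>{\<sigma>. ?W j \<sigma>}. cylinder \<sigma>)"
        by (intro UN_I[of "restr X l"]) (simp_all add: mem_cylinder_iff)
    next
      fix j X assume "X \<in> (\<Union>\<sigma>\<in>{\<sigma>. ?W j \<sigma>}. cylinder \<sigma>)"
      then obtain \<sigma> where "?W j \<sigma>" "restr X (length \<sigma>) = \<sigma>" by (auto simp: mem_cylinder_iff)
      then show "X \<in> U j" using cong[of "(!) \<sigma>" "length \<sigma>" X j] by (auto simp: U_def restr_nth)
    qed
  qed
  moreover have "measure lebesgue_cantor (U j) \<le> (1/2) ^ j" for j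
  proof -
    have bound: "measure lebesgue_cantor {X. C j l X} \<le> (1/2) ^ j" for l
    proof (cases "\<exists>X. C j l X")
      case True
      then have pl: "p ` {..<j} \<subseteq> {..<l}" by (auto simp: C_def)
      have card_p: "card (p ` {..<j}) = j" using p(2) by (simp add: card_image inj_on_subset)
      then have "j \<le> l" using card_mono[OF _ pl] by simp
      define S where "S = {b :: nat. b < 2 ^ l \<and> C j l (bit b)}"
      \<comment> \<open>A member of \<open>S\<close> is determined by its bits off the
        \<open>j\<close> positions: they contain the oracle, and the simulation then returns the
        remaining bits.\<close>
      have "inj_on (\<lambda>b. {i. i < l \<and> bit b i} - p ` {..<j}) S"
      proof (rule inj_onI)
        fix b c assume b: "b \<in> S" and c: "c \<in> S"
          and eq: "{i. i < l \<and> bit b i} - p ` {..<j} = {i. i < l \<and> bit c i} - p ` {..<j}"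
        have off: "bit b i = bit c i" if "i < l" "i \<notin> p ` {..<j}" for i using eq that by blast
        have "enc (\<lambda>m. q m \<and> bit b m) l = enc (\<lambda>m. q m \<and> bit c m) l"
          using off p(3) by (intro enc_cong) blast
        then have "bit b (p k) = bit c (p k)" if "k < j" for k
          using b c that by (auto simp: S_def C_def of_bool_eq_iff)
        then have "bit b i = bit c i" if "i < l" for i using off[OF that] by blast
        then have "enc (bit b) l = enc (bit c) l" by (intro enc_cong)
        then show "b = c" using b c by (simp add: S_def enc_bit)
      qed
      moreover have "(\<lambda>b. {i. i < l \<and> bit b i} - p ` {..<j}) ` S \<subseteq> Pow ({..<l} - p ` {..<j})" by auto
      ultimately have "card S \<le> card (Pow ({..<l} - p ` {..<j}))" by (rule card_inj_on_le) simp
      also have "\<dots> = 2 ^ (l - j)" using pl card_p by (simp add: card_Pow card_Diff_subset)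
      finally have "real (card S) / 2 ^ l \<le> 2 ^ (l - j) / 2 ^ l"
        by (intro divide_right_mono) (simp_all add: numeral_power_le_of_nat_cancel_iff flip: of_nat_le_iff)
      also have "\<dots> = (1/2) ^ j" using \<open>j \<le> l\<close> by (simp add: power_diff power_one_over)
      finally show ?thesis by (subst measure_prefix_event[OF cong]) (simp_all add: S_def)
    qed simp
    have "(\<lambda>l. measure lebesgue_cantor {X. C j l X}) \<longlonglongrightarrow> measure lebesgue_cantor (\<Union>l. {X. C j l X})"
    proof (rule lebesgue_cantor.finite_Lim_measure_incseq)
      show "range (\<lambda>l. {X. C j l X}) \<subseteq> sets lebesgue_cantor"
        using sets_prefix_event[OF cong] by auto
      show "incseq (\<lambda>l. {X. C j l X})" using mono by (auto simp: incseq_def)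
    qed
    moreover have "(\<Union>l. {X. C j l X}) = U j" by (auto simp: U_def)
    ultimately show ?thesis using bound by (auto intro: LIMSEQ_le_const2)
  qed
  ultimately have "martin_lof_test lebesgue_cantor U" by (simp add: martin_lof_test_def)
  moreover have "Z \<in> U j" for j
  proof -
    have "\<forall>\<^sub>F l in sequentially. \<forall>k\<in>{..<j}. p k < l \<and> sim l (enc (\<lambda>m. q m \<and> Z m) l) e [p k] = Suc (of_bool (Z (p k)))"
    proof (rule eventually_ball_finite)
      show "\<forall>k\<in>{..<j}. \<forall>\<^sub>F l in sequentially. p k < l \<and> sim l (enc (\<lambda>m. q m \<and> Z m) l) e [p k] = Suc (of_bool (Z (p k)))"
        using e[of "p _"] eventually_gt_at_top by (auto simp: WZ eventually_conj)
    qed simp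
    then have "\<exists>l. \<forall>k\<in>{..<j}. p k < l \<and> sim l (enc (\<lambda>m. q m \<and> Z m) l) e [p k] = Suc (of_bool (Z (p k)))"
      by (rule eventually_happens'[OF sequentially_bot])
    then show ?thesis by (auto simp: U_def C_def)
  qed
  ultimately show False using random unfolding martin_lof_random_def by blast
qed


section \<open>Measures induced by length-preserving functionals\<close>

lemma rec_fun_card [rec_intros]:
  assumes "dec_pred A (\<lambda>w. P (w 0) (\<lambda>i. w (Suc i)))" and "rec_fun A n"
  shows "rec_fun A (\<lambda>v. card {b. b < n v \<and> P b v})"
proof -
  have "rec_fun A (\<lambda>w. of_bool (P (w 0) (\<lambda>i. w (Suc (Suc i)))))"
    using rec_fun_compose[OF assms(1)[unfolded dec_pred_def],
        of "\<lambda>i v. v (if i = 0 then 0 else Suc i)"] rec_fun_var by simp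
  then have "dec_pred A (\<lambda>w. P (w 0) (\<lambda>i. w (Suc (Suc i))))" by (simp add: dec_pred_def)
  then have "rec_fun A (\<lambda>v. rec_nat 0 (\<lambda>b y. y + of_bool (P b v)) (n v))"
    by (intro rec_intros assms(2))
  moreover have "rec_nat 0 (\<lambda>b y. y + of_bool (P b v)) n = card {b. b < n \<and> P b v}" for v n
  proof (induction n)
    case (Suc n)
    have "{b. b < Suc n \<and> P b v} = {b. b < n \<and> P b v} \<union> (if P n v then {n} else {})"
      by (auto simp: less_Suc_eq)
    then show ?case using Suc by simp
  qed simp
  ultimately show ?thesis by simp
qed

lemma card_bounded_pos_iff:
  "0 < real (card {b :: nat. b < N \<and> P b}) / 2 ^ l \<longleftrightarrow> (\<exists>b<N. P b)"
  by (auto simp: zero_less_divide_iff card_gt_0_iff)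

text \<open>An output bit depends on finitely many input bits, those up to its own position. Hence
  it is enough to ask for decidability on the inputs \<open>bit b\<close>, which realise all finite
  prefixes.\<close>

locale causal_functional =
  fixes F :: "(nat \<Rightarrow> bool) \<Rightarrow> nat \<Rightarrow> bool"
  assumes causal: "(\<And>i. i \<le> m \<Longrightarrow> X i = Y i) \<Longrightarrow> F X m = F Y m"
    and dec: "dec_pred (\<lambda>_. False) (\<lambda>v. F (bit (v 0)) (v 1))"
begin

lemma restr_cong:
  assumes "restr X l = restr Y l"
  shows "restr (F X) l = restr (F Y) l"
  unfolding restr_eq_iff
proof (intro allI impI)
  fix m assume "m < l"
  then show "F X m = F Y m" using assms unfolding restr_eq_iff by (intro causal) simp
qed

lemma measurable: "F \<in> lebesgue_cantor \<rightarrow>\<^sub>M borel"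
proof (rule borel_measurableI)
  fix S :: "(nat \<Rightarrow> bool) set" assume S: "open S"
  have "open (F -` S)"
  proof (subst open_subopen, intro ballI)
    fix X assume "X \<in> F -` S"
    then obtain l where l: "cylinder (restr (F X) l) \<subseteq> S" using ex_cylinder_subset[OF S] by blast
    have "cylinder (restr X l) \<subseteq> F -` S"
    proof
      fix Y assume "Y \<in> cylinder (restr X l)"
      then have "restr (F Y) l = restr (F X) l" by (intro restr_cong) (simp add: mem_cylinder_iff)
      then show "Y \<in> F -` S" using l by (auto simp: mem_cylinder_iff)
    qed
    then show "\<exists>T. open T \<and> X \<in> T \<and> T \<subseteq> F -` S"
      using open_cylinder by (intro exI[of _ "cylinder (restr X l)"]) (simp add: mem_cylinder_iff)
  qed
  then show "F -` S \<inter> space lebesgue_cantor \<in> sets lebesgue_cantor"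
    by (simp add: sets_lebesgue_cantor)
qed

definition \<mu> :: "(nat \<Rightarrow> bool) measure" where
  "\<mu> = distr lebesgue_cantor borel F"

lemma probability_on_cantor: "probability_on_cantor \<mu>"
  unfolding probability_on_cantor_def \<mu>_def
  using lebesgue_cantor.prob_space_distr[OF measurable] by simp

lemma measure_eq:
  assumes "S \<in> sets borel"
  shows "measure \<mu> S = measure lebesgue_cantor {X. F X \<in> S}"
  using measure_distr[OF measurable assms] by (simp add: \<mu>_def vimage_def)

text \<open>Since \<open>F\<close> preserves length, the preimage of a cylinder is decided by
  equally many input bits and can be counted.\<close>

lemma measure_cylinder:
  "measure \<mu> (cylinder \<sigma>) =
    card {b :: nat. b < 2 ^ length \<sigma> \<and> restr (F (bit b)) (length \<sigma>) = \<sigma>} / 2 ^ length \<sigma>"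
proof -
  have "measure \<mu> (cylinder \<sigma>) = measure lebesgue_cantor {X. restr (F X) (length \<sigma>) = \<sigma>}"
    using measure_eq[of "cylinder \<sigma>"] open_cylinder by (simp add: mem_cylinder_iff)
  also have "\<dots> = card {b :: nat. b < 2 ^ length \<sigma> \<and> restr (F (bit b)) (length \<sigma>) = \<sigma>} / 2 ^ length \<sigma>"
    using restr_cong by (intro measure_prefix_event) metis
  finally show ?thesis .
qed

lemma restr_F_eq_iff:
  "restr (F (bit b)) (length \<sigma>) = \<sigma> \<longleftrightarrow>
    (\<forall>i<len_code (str_code \<sigma>). F (bit b) i = bit (Suc (str_code \<sigma>)) i)"
proof -
  have "restr (F (bit b)) (length \<sigma>) = \<sigma> \<longleftrightarrow>
      restr (F (bit b)) (length \<sigma>) = restr (bit (Suc (str_code \<sigma>))) (length \<sigma>)"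
    unfolding restr_bit_str_code ..
  then show ?thesis unfolding restr_eq_iff len_code_str_code .
qed

lemma computable_measure: "computable_measure \<mu>"
  unfolding computable_measure_def computable_real_fun_def
proof (intro exI conjI allI)
  let ?a = "\<lambda>xs. card {b :: nat. b < 2 ^ len_code (xs ! 0) \<and>
    (\<forall>i<len_code (xs ! 0). F (bit b) i = bit (Suc (xs ! 0)) i)}"
  \<comment> \<open>The measure of a cylinder is an exact dyadic fraction, so one value serves every
    precision. The \<open>- 1\<close> compensates for the denominator \<open>c + 1\<close> of the
    representation.\<close>
  let ?c = "\<lambda>xs. 2 ^ len_code (xs ! 0) - 1"
  show "computable 2 ?a"
    unfolding computable_iff by (simp add: numeral_2_eq_2) (intro rec_intros dec_pred_lift2[OF dec])
  show "computable 2 (\<lambda>_. 0)" unfolding computable_iff by (intro rec_intros)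
  show "computable 2 ?c"
    unfolding computable_iff by (simp add: numeral_2_eq_2) (intro rec_intros)
  show "let v = [str_code \<sigma>, k] in
     \<bar>(real (?a v) - real 0) / (real (?c v) + 1) - measure \<mu> (cylinder \<sigma>)\<bar> \<le> (1/2) ^ k" for \<sigma> k
    unfolding measure_cylinder restr_F_eq_iff by (simp add: Let_def len_code_str_code of_nat_diff)
qed

text \<open>A cylinder has positive measure when some input prefix is mapped into it. If this holds
  along all prefixes of \<open>Y\<close>, compactness (\<open>konig\<close>) yields a single
  preimage of \<open>Y\<close>.\<close>

lemma support_eq: "support \<mu> = range F"
proof -
  have "measure \<mu> (cylinder (restr Y l)) > 0 \<longleftrightarrow> (\<exists>X. restr (F X) l = restr Y l)" for Y l
  proof -
    have "measure \<mu> (cylinder (restr Y l)) > 0 \<longleftrightarrow> (\<exists>b :: nat<2 ^ l. restr (F (bit b)) l = restr Y l)"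
      by (simp only: measure_cylinder length_restr card_bounded_pos_iff not_not)
    also have "\<dots> \<longleftrightarrow> (\<exists>X. restr (F X) l = restr Y l)"
    proof
      assume "\<exists>X. restr (F X) l = restr Y l"
      then obtain X where "restr (F X) l = restr Y l" by blast
      moreover have "restr (F (bit (enc X l))) l = restr (F X) l"
        by (rule restr_cong) (simp add: restr_eq_iff bit_enc)
      ultimately show "\<exists>b :: nat<2 ^ l. restr (F (bit b)) l = restr Y l" using enc_less[of X l] by metis
    qed blast
    finally show ?thesis .
  qed
  then have eq: "support \<mu> = {Y. \<forall>l. \<exists>X. restr (F X) l = restr Y l}" by (simp add: support_def)
  show ?thesis
  proof (intro set_eqI iffI)
    fix Y assume "Y \<in> support \<mu>"
    then have Y: "\<exists>X. restr (F X) l = restr Y l" for l by (simp add: eq)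
    define T where "T \<sigma> \<longleftrightarrow> restr (F ((!) \<sigma>)) (length \<sigma>) = restr Y (length \<sigma>)" for \<sigma>
    have T: "T (restr X l) \<longleftrightarrow> restr (F X) l = restr Y l" for X l
      using restr_cong[of "(!) (restr X l)" l X] by (simp add: T_def restr_eq_iff)
    have "\<exists>X. \<forall>l. T (restr X l)"
    proof (rule konig)
      show "\<exists>X. T (restr X l)" for l using Y by (simp add: T)
      show "T (restr X k)" if "k \<le> l" "T (restr X l)" for X k l
        using that unfolding T restr_eq_iff by auto
    qed
    then obtain X where "\<forall>l. restr (F X) l = restr Y l" unfolding T by blast
    then have "F X = Y" by (auto simp: restr_eq_iff)
    then show "Y \<in> range F" by blast
  qed (auto simp: eq)
qed

text \<open>The complement is covered by the strings that no input of the same length produces, a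
  property decided by a finite search.\<close>

lemma Pi01_class_range: "Pi01_class (range F)"
  unfolding Pi01_class_def
proof (intro exI conjI)
  let ?W = "\<lambda>\<sigma>. \<not> (\<exists>b :: nat<2 ^ length \<sigma>. restr (F (bit b)) (length \<sigma>) = \<sigma>)"
  show "Sigma_pred 1 1 (\<lambda>xs. ?W (inv str_code (xs ! 0)))"
  proof (rule dec_pred_imp_Sigma1_str)
    show "dec_pred (\<lambda>_. False) (\<lambda>v. \<not> (\<exists>b :: nat<2 ^ len_code (v 0). \<forall>i<len_code (v 0).
        F (bit b) i = bit (Suc (v 0)) i))"
      by (intro rec_intros dec_pred_lift2[OF dec])
    show "?W \<sigma> \<longleftrightarrow> \<not> (\<exists>b :: nat<2 ^ len_code (str_code \<sigma>). \<forall>i<len_code (str_code \<sigma>).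
        F (bit b) i = bit (Suc (str_code \<sigma>)) i)" for \<sigma>
      unfolding restr_F_eq_iff len_code_str_code ..
  qed
  have "Y \<in> support \<mu> \<longleftrightarrow> (\<forall>\<sigma>. Y \<in> cylinder \<sigma> \<longrightarrow> \<not> ?W \<sigma>)" for Y
  proof -
    have pos: "measure \<mu> (cylinder \<sigma>) > 0 \<longleftrightarrow> \<not> ?W \<sigma>" for \<sigma>
      by (simp only: measure_cylinder length_restr card_bounded_pos_iff not_not)
    have "Y \<in> support \<mu> \<longleftrightarrow> (\<forall>l. \<not> ?W (restr Y l))" unfolding support_def pos by blast
    also have "\<dots> \<longleftrightarrow> (\<forall>\<sigma>. Y \<in> cylinder \<sigma> \<longrightarrow> \<not> ?W \<sigma>)"
      unfolding mem_cylinder_iff by (metis length_restr)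
    finally show ?thesis .
  qed
  then show "range F = - (\<Union>\<sigma>\<in>{\<sigma>. ?W \<sigma>}. cylinder \<sigma>)" unfolding support_eq[symmetric] by blast
qed

lemma countably_supported:
  assumes "countable (range F)"
  shows "countably_supported \<mu>"
proof -
  have "range F \<in> sets borel" by (rule sets.countable[OF singleton_in_borel assms])
  then have "measure \<mu> (range F) = 1" using lebesgue_cantor.prob_space by (simp add: measure_eq)
  moreover have "range (from_nat_into (range F)) = range F"
    using assms by (simp add: range_from_nat_into)
  ultimately show ?thesis unfolding countably_supported_def by metis
qed

text \<open>Preimages of tests are tests.\<close>

lemma martin_lof_random:
  assumes "martin_lof_random lebesgue_cantor Z"
  shows "martin_lof_random \<mu> (F Z)"
  unfolding martin_lof_random_def
proof (intro allI impI)
  fix U assume U: "martin_lof_test \<mu> U"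
  then obtain W where W: "Sigma_pred 1 2 (\<lambda>xs. W (xs ! 0) (inv str_code (xs ! 1)))"
    "\<And>i. U i = (\<Union>\<sigma>\<in>{\<sigma>. W i \<sigma>}. cylinder \<sigma>)"
    unfolding martin_lof_test_def uniformly_Sigma01_def by blast
  obtain V where V: "dec_pred (\<lambda>_. False) (\<lambda>v. V (v 0) (v 1) (v 2))"
    "\<And>i \<sigma>. W i \<sigma> \<longleftrightarrow> (\<exists>a. V a i (str_code \<sigma>))"
    using W(1) unfolding Sigma1_nat_str_iff by blast
  \<comment> \<open>This is the action of \<open>F\<close> on strings: by causality the first
    \<open>length \<sigma>\<close> output bits depend only on \<sigma>. A string is enumerated into
    the preimage when its image is enumerated into \<open>U i\<close>.\<close>
  let ?f = "\<lambda>\<sigma>. restr (F ((!) \<sigma>)) (length \<sigma>)"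
  have f: "str_code (?f \<sigma>) = enc (F (bit (Suc (str_code \<sigma>)))) (len_code (str_code \<sigma>))
      + 2 ^ len_code (str_code \<sigma>) - 1" for \<sigma>
  proof -
    have "restr ((!) \<sigma>) (length \<sigma>) = restr (bit (Suc (str_code \<sigma>))) (length \<sigma>)"
      by (simp add: restr_nth restr_bit_str_code)
    from restr_cong[OF this] show ?thesis by (simp add: str_code_restr len_code_str_code)
  qed
  define U' where "U' i = {X. F X \<in> U i}" for i
  have "uniformly_Sigma01 U'"
    unfolding uniformly_Sigma01_def
  proof (intro exI conjI)
    let ?V = "\<lambda>a i c. V a i (enc (F (bit (Suc c))) (len_code c) + 2 ^ len_code c - 1)"
    have "dec_pred (\<lambda>_. False) (\<lambda>v. ?V (v 0) (v 1) (v 2))"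
      by (intro rec_intros dec_pred_lift2[OF dec] dec_pred_lift3[OF V(1)])
    then show "Sigma_pred 1 2 (\<lambda>xs. W (xs ! 0) (?f (inv str_code (xs ! 1))))"
      unfolding Sigma1_nat_str_iff[of "\<lambda>i \<sigma>. W i (?f \<sigma>)"] unfolding V(2) f by (intro exI[of _ ?V]) blast
    show "\<forall>i. U' i = (\<Union>\<sigma>\<in>{\<sigma>. W i (?f \<sigma>)}. cylinder \<sigma>)"
    proof (intro allI set_eqI iffI)
      fix i X assume "X \<in> U' i"
      then obtain \<sigma> where \<sigma>: "W i \<sigma>" "restr (F X) (length \<sigma>) = \<sigma>"
        by (auto simp: U'_def W(2) mem_cylinder_iff)
      have "restr (F ((!) (restr X (length \<sigma>)))) (length \<sigma>) = \<sigma>"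
        using restr_cong[of "(!) (restr X (length \<sigma>))" "length \<sigma>" X] \<sigma>(2) by (simp add: restr_eq_iff)
      then have "W i (?f (restr X (length \<sigma>)))" using \<sigma>(1) by simp
      then show "X \<in> (\<Union>\<sigma>\<in>{\<sigma>. W i (?f \<sigma>)}. cylinder \<sigma>)"
        by (intro UN_I[of "restr X (length \<sigma>)"]) (simp_all add: mem_cylinder_iff)
    next
      fix i X assume "X \<in> (\<Union>\<sigma>\<in>{\<sigma>. W i (?f \<sigma>)}. cylinder \<sigma>)"
      then obtain \<sigma> where \<sigma>: "W i (?f \<sigma>)" "restr X (length \<sigma>) = \<sigma>" by (auto simp: mem_cylinder_iff)
      then have "restr (F X) (length \<sigma>) = ?f \<sigma>" by (intro restr_cong) (simp add: restr_nth)
      then have "F X \<in> cylinder (?f \<sigma>)" by (simp add: mem_cylinder_iff)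
      then show "X \<in> U' i" using \<sigma>(1) by (auto simp: U'_def W(2))
    qed
  qed
  moreover have "measure lebesgue_cantor (U' i) \<le> (1/2) ^ i" for i
  proof -
    have "open (U i)" unfolding W(2) by (intro open_UN) (simp add: open_cylinder)
    then have "measure \<mu> (U i) = measure lebesgue_cantor (U' i)"
      unfolding U'_def by (intro measure_eq borel_open)
    moreover have "measure \<mu> (U i) \<le> (1/2) ^ i" using U unfolding martin_lof_test_def by blast
    ultimately show ?thesis by simp
  qed
  ultimately have "martin_lof_test lebesgue_cantor U'" by (simp add: martin_lof_test_def)
  then have "Z \<notin> (\<Inter>i. U' i)" using assms unfolding martin_lof_random_def by blast
  then show "F Z \<notin> (\<Inter>i. U i)" by (simp add: U'_def)
qed

end


section \<open>Cantor-Bendixson ranks\<close>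

lemma rk_in_eqI:
  assumes "X \<in> CB P \<beta>" and "X \<notin> CB P (osucc \<beta>)"
  shows "rk_in P X = \<beta>"
  unfolding rk_in_def
proof (rule Least_equality)
  show "\<beta> \<le> \<gamma>" if "X \<in> CB P \<gamma> - CB P (osucc \<gamma>)" for \<gamma>
  proof (rule ccontr)
    assume "\<not> \<beta> \<le> \<gamma>"
    then have "osucc \<gamma> \<le> \<beta>" using less_osucc_iff not_less by metis
    then show False using CB_antimono assms(1) that by blast
  qed
qed (use assms in simp)

text \<open>\<open>P\<close> bounds the rank from above; survival up to stage \<beta> in every class
  containing \<open>X\<close> excludes smaller ranks.\<close>

lemma rk_eqI:
  assumes "Pi01_class P" and "X \<in> CB P \<beta>" and "X \<notin> CB P (osucc \<beta>)"
    and minimal: "\<And>Q. Pi01_class Q \<Longrightarrow> X \<in> Q \<Longrightarrow> X \<in> CB Q \<beta>"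
  shows "rk X = \<beta>"
  unfolding rk_def
proof (rule Least_equality)
  have "X \<in> P" using assms(2) CB_antimono[OF ozero_le] CB_zero by blast
  then show "\<exists>P. Pi01_class P \<and> X \<in> P \<and> has_rk_in P X \<and> \<beta> = rk_in P X"
    using assms(1-3) rk_in_eqI[OF assms(2,3)] unfolding has_rk_in_def by blast
next
  fix \<gamma> assume "\<exists>P. Pi01_class P \<and> X \<in> P \<and> has_rk_in P X \<and> \<gamma> = rk_in P X"
  then obtain Q \<delta> where Q: "Pi01_class Q" "X \<in> Q" "\<gamma> = rk_in Q X" "X \<in> CB Q \<delta>" "X \<notin> CB Q (osucc \<delta>)"
    unfolding has_rk_in_def by blast
  then have "\<gamma> = \<delta>" using rk_in_eqI by blast
  show "\<beta> \<le> \<gamma>"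
  proof (rule ccontr)
    assume "\<not> \<beta> \<le> \<gamma>"
    then have "osucc \<delta> \<le> \<beta>" using less_osucc_iff not_less \<open>\<gamma> = \<delta>\<close> by metis
    then show False using CB_antimono minimal[OF Q(1,2)] Q(5) by blast
  qed
qed


section \<open>Comparing a sequence with an approximation, column by column\<close>

text \<open>Column \<open>i\<close> of a sequence consists of its values at the positions \<open>n * k + i\<close>. At stage \<open>t\<close> the
  functional \<open>F\<close> outputs on each column whether the next longer initial segment of the column
  agrees with the approximation \<open>g t\<close>; \<open>cnt X i t\<close> is the number of successes before stage \<open>t\<close>.\<close>

locale column_matching =
  fixes n :: nat and g :: "nat \<Rightarrow> nat \<Rightarrow> bool" and Z :: "nat \<Rightarrow> bool"
  assumes n_pos: "n > 0" and limit: "limit_computes g Z"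
begin

text \<open>With \<open>c\<close> earlier successes the test covers bits 0 to \<open>c\<close>. The
  bits already matched are compared again because the approximation may have changed; this is what
  stops the successes on a wrong column.\<close>

definition agree :: "nat \<Rightarrow> nat \<Rightarrow> nat \<Rightarrow> (nat \<Rightarrow> bool) \<Rightarrow> bool" where
  "agree i c t X \<longleftrightarrow> (\<forall>k\<le>c. X (n * k + i) = g t (n * k + i))"

definition cnt :: "(nat \<Rightarrow> bool) \<Rightarrow> nat \<Rightarrow> nat \<Rightarrow> nat" where
  "cnt X i t = rec_nat 0 (\<lambda>t c. c + of_bool (agree i c t X)) t"

definition F :: "(nat \<Rightarrow> bool) \<Rightarrow> nat \<Rightarrow> bool" where
  "F X m \<longleftrightarrow> agree (m mod n) (cnt X (m mod n) (m div n)) (m div n) X"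

lemma dec_g: "dec_pred A (\<lambda>v. g (v 0) (v 1))"
  using limit unfolding limit_computes_def by (blast intro: dec_pred_any_oracle)

lemma eventually_g: "\<forall>\<^sub>F t in sequentially. g t m = Z m"
  using limit unfolding limit_computes_def by blast

lemma eventually_g_column: "\<forall>\<^sub>F t in sequentially. \<forall>k\<le>c. g t (n * k + i) = Z (n * k + i)"
proof -
  have "\<forall>\<^sub>F t in sequentially. \<forall>k\<in>{..c}. g t (n * k + i) = Z (n * k + i)"
    by (intro eventually_ball_finite) (simp_all add: eventually_g)
  then show ?thesis by (simp add: Ball_def)
qed

lemma cnt_0 [simp]: "cnt X i 0 = 0"
  by (simp add: cnt_def)

lemma F_column: "i < n \<Longrightarrow> F X (n * t + i) \<longleftrightarrow> agree i (cnt X i t) t X"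
  using n_pos by (simp add: F_def)

lemma cnt_Suc: "i < n \<Longrightarrow> cnt X i (Suc t) = cnt X i t + of_bool (F X (n * t + i))"
  by (simp add: F_column) (simp add: cnt_def)

lemma cnt_le: "i < n \<Longrightarrow> cnt X i t \<le> t"
  by (induction t) (auto simp: cnt_Suc)

lemma cnt_mono: "i < n \<Longrightarrow> s \<le> t \<Longrightarrow> cnt X i s \<le> cnt X i t"
  by (rule lift_Suc_mono_le) (simp_all add: cnt_Suc)

text \<open>The count can be recovered from the output alone. This serves to isolate finite columns
  and to compute \<open>Z\<close> from \<open>F Z\<close>.\<close>

lemma cnt_eq_card: "i < n \<Longrightarrow> cnt X i t = card {s. s < t \<and> F X (n * s + i)}"
proof (induction t)
  case (Suc t)
  have "{s. s < Suc t \<and> F X (n * s + i)} =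
      {s. s < t \<and> F X (n * s + i)} \<union> (if F X (n * t + i) then {t} else {})"
    by (auto simp: less_Suc_eq)
  then show ?case using Suc by (simp add: cnt_Suc)
qed simp

lemma cnt_cong:
  assumes "i < n" and "\<And>k. k < t \<Longrightarrow> X (n * k + i) = Y (n * k + i)"
  shows "cnt X i t = cnt Y i t"
  using assms(2)
proof (induction t)
  case (Suc t)
  then have "cnt X i t = cnt Y i t" by simp
  moreover have "agree i (cnt X i t) t X \<longleftrightarrow> agree i (cnt X i t) t Y"
    using Suc.prems cnt_le[OF assms(1), of X t] by (auto simp: agree_def)
  ultimately show ?case using assms(1) by (simp add: cnt_Suc F_column)
qed simp

text \<open>By \<open>cnt_le\<close>, stage \<open>t\<close> inspects only bits 0 to
  \<open>t\<close> of its own column. This gives both causality and the independence of the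
  columns.\<close>

lemma F_column_cong:
  assumes "i < n" and "\<And>k. k \<le> t \<Longrightarrow> X (n * k + i) = Y (n * k + i)"
  shows "F X (n * t + i) = F Y (n * t + i)"
proof -
  have "cnt X i t = cnt Y i t" using assms by (intro cnt_cong) auto
  moreover have "agree i (cnt X i t) t X \<longleftrightarrow> agree i (cnt X i t) t Y"
    using assms(2) cnt_le[OF assms(1), of X t] by (auto simp: agree_def)
  ultimately show ?thesis using assms(1) by (simp add: F_column)
qed

lemma column_cases:
  obtains i t where "i < n" and "m = n * t + i"
  using n_pos that[of "m mod n" "m div n"] by simp

sublocale causal_functional F
proof
  fix m :: nat and X Y :: "nat \<Rightarrow> bool"
  assume eq: "\<And>i. i \<le> m \<Longrightarrow> X i = Y i"
  obtain i t where "i < n" "m = n * t + i" by (rule column_cases)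
  then show "F X m = F Y m" using eq by (auto intro!: F_column_cong)
next
  show "dec_pred (\<lambda>_. False) (\<lambda>v. F (bit (v 0)) (v 1))"
    unfolding F_def cnt_def agree_def by (intro rec_intros dec_pred_lift2[OF dec_g])
qed

lemma dec_F_oracle:
  assumes "dec_pred A (\<lambda>v. X (v 0))"
  shows "dec_pred A (\<lambda>v. F X (v 0))"
  unfolding F_def cnt_def agree_def
  by (intro rec_intros dec_pred_lift2[OF dec_g] dec_pred_lift1[OF assms])


section \<open>Columns with infinitely many ones\<close>

definition inf_col :: "(nat \<Rightarrow> bool) \<Rightarrow> nat \<Rightarrow> bool" where
  "inf_col Y i \<longleftrightarrow> (\<forall>T. \<exists>t\<ge>T. Y (n * t + i))"

lemma cnt_const:
  assumes "i < n" and "\<And>t. t \<ge> T \<Longrightarrow> \<not> F X (n * t + i)" and "t \<ge> T"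
  shows "cnt X i t = cnt X i T"
  using assms(3) by (induction t rule: dec_induct) (simp_all add: cnt_Suc assms)

lemma inf_col_cnt_unbounded:
  assumes "i < n" and "inf_col (F X) i"
  shows "\<exists>t. c \<le> cnt X i t"
proof (induction c)
  case (Suc c)
  then obtain s where s: "c \<le> cnt X i s" by blast
  obtain t where "t \<ge> s" "F X (n * t + i)" using assms(2) unfolding inf_col_def by blast
  then have "Suc c \<le> cnt X i (Suc t)"
    using s cnt_mono[OF assms(1), of s t X] by (simp add: cnt_Suc assms(1))
  then show ?case by blast
qed simp

text \<open>With infinitely many successes, bit \<open>k\<close> is compared at arbitrarily late
  stages, when the approximation is correct. Conversely, if the successes on a correct column
  stopped at count \<open>c\<close>, the test would still succeed once the approximation had settled
  on bits 0 to \<open>c\<close>.\<close>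

lemma inf_col_F_iff:
  assumes "i < n"
  shows "inf_col (F X) i \<longleftrightarrow> (\<forall>k. X (n * k + i) = Z (n * k + i))"
proof
  assume inf: "inf_col (F X) i"
  show "\<forall>k. X (n * k + i) = Z (n * k + i)"
  proof
    fix k
    obtain s where s: "k \<le> cnt X i s" using inf_col_cnt_unbounded[OF assms inf] by blast
    obtain T where T: "\<And>t. t \<ge> T \<Longrightarrow> g t (n * k + i) = Z (n * k + i)"
      using eventually_g unfolding eventually_sequentially by blast
    obtain t where t: "t \<ge> max s T" "F X (n * t + i)" using inf unfolding inf_col_def by blast
    then have "k \<le> cnt X i t" using s cnt_mono[OF assms, of s t X] by simp
    then show "X (n * k + i) = Z (n * k + i)" using t T[of t] by (simp add: F_column assms agree_def)
  qed
next
  assume eq: "\<forall>k. X (n * k + i) = Z (n * k + i)"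
  show "inf_col (F X) i"
  proof (rule ccontr)
    assume "\<not> inf_col (F X) i"
    then obtain T where T: "\<And>t. t \<ge> T \<Longrightarrow> \<not> F X (n * t + i)" unfolding inf_col_def by blast
    obtain T' where T': "\<And>t. t \<ge> T' \<Longrightarrow> \<forall>k\<le>cnt X i T. g t (n * k + i) = Z (n * k + i)"
      using eventually_g_column unfolding eventually_sequentially by blast
    let ?t = "max T T'"
    have "cnt X i ?t = cnt X i T" by (rule cnt_const[OF assms T]) simp_all
    then have "F X (n * ?t + i)" using T'[of ?t] eq by (simp add: F_column assms agree_def)
    then show False using T[of ?t] by simp
  qed
qed

text \<open>The input column is that of \<open>Z\<close>, and columns are processed independently.
  So an infinite column carries no information beyond its index.\<close>

lemma inf_col_F_eq:
  assumes "i < n" and "inf_col (F X) i"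
  shows "F X (n * t + i) = F Z (n * t + i)"
  using assms inf_col_F_iff by (intro F_column_cong) auto

text \<open>Once the approximation has settled on the first \<open>c + 1\<close> bits of the column, where \<open>c\<close> is the
  final number of successes, one further failure implies that all later comparisons fail.\<close>

lemma finite_col_isolated:
  assumes "i < n" and "\<not> inf_col (F X) i"
  shows "\<exists>L. \<forall>Y. (\<forall>m<L. F Y m = F X m) \<longrightarrow> (\<forall>t. F Y (n * t + i) = F X (n * t + i))"
proof -
  obtain T where T: "\<And>t. t \<ge> T \<Longrightarrow> \<not> F X (n * t + i)" using assms(2) unfolding inf_col_def by blast
  define c where "c = cnt X i T"
  obtain T' where T': "\<And>t. t \<ge> T' \<Longrightarrow> \<forall>k\<le>c. g t (n * k + i) = Z (n * k + i)"
    using eventually_g_column unfolding eventually_sequentially by blast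
  define s where "s = max T T'"
  \<comment> \<open>A prefix of length \<open>n * Suc s\<close> shows column \<open>i\<close> up to
    and including stage \<open>s\<close>, where the decisive failure occurs.\<close>
  have "F Y (n * t + i) = F X (n * t + i)" if Y: "\<forall>m<n * Suc s. F Y m = F X m" for Y t
  proof -
    have init: "F Y (n * t + i) = F X (n * t + i)" if "t \<le> s" for t
    proof -
      have "n * t \<le> n * s" using that by (rule mult_le_mono2)
      then have "n * t + i < n * Suc s" unfolding mult_Suc_right using assms(1) by linarith
      then show ?thesis using Y by blast
    qed
    have "cnt Y i s = cnt X i s"
      unfolding cnt_eq_card[OF assms(1)] using init by (intro arg_cong[of _ _ card]) auto
    also have "\<dots> = c" unfolding c_def by (rule cnt_const[OF assms(1) T]) (simp_all add: s_def)
    finally have cnt_s: "cnt Y i s = c" .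
    have fail_s: "\<not> agree i c s Y"
      using init[of s] T[of s] cnt_s by (simp add: F_column assms(1) s_def)
    have fail: "\<not> agree i c t Y" if "t \<ge> s" for t
    proof -
      have "t \<ge> T'" "s \<ge> T'" using that by (simp_all add: s_def)
      then have "\<forall>k\<le>c. g t (n * k + i) = g s (n * k + i)" using T' by metis
      then show ?thesis using fail_s unfolding agree_def by metis
    qed
    have "cnt Y i t = c" if "t \<ge> s" for t
      using that
    proof (induction t rule: dec_induct)
      case (step t)
      then show ?case using fail by (simp add: cnt_Suc F_column assms(1))
    qed (rule cnt_s)
    then have "\<not> F Y (n * t + i)" if "t \<ge> s" for t using that fail by (simp add: F_column assms(1))
    then show ?thesis using init T by (metis max.cobounded1 nle_le order_trans s_def)
  qed
  then show ?thesis by blast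
qed


section \<open>Countability of the range\<close>

definition inf_cols :: "(nat \<Rightarrow> bool) \<Rightarrow> nat set" where
  "inf_cols Y = {i. i < n \<and> inf_col Y i}"

lemma finite_inf_cols [simp]: "finite (inf_cols Y)"
  by (simp add: inf_cols_def)

lemma range_F_eqI:
  assumes "inf_cols (F Y) = inf_cols (F X)"
    and "\<And>i t. i < n \<Longrightarrow> i \<notin> inf_cols (F X) \<Longrightarrow> F Y (n * t + i) = F X (n * t + i)"
  shows "F Y = F X"
proof
  fix m
  obtain i t where m: "i < n" "m = n * t + i" by (rule column_cases)
  show "F Y m = F X m"
  proof (cases "i \<in> inf_cols (F X)")
    case True
    then have "inf_col (F X) i" "inf_col (F Y) i" using assms(1) by (auto simp: inf_cols_def)
    then show ?thesis using inf_col_F_eq[OF m(1)] m(2) by metis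
  qed (use assms(2) m in simp)
qed

text \<open>A point is determined by the set \<open>S\<close> of its infinite columns, which are
  copied from \<open>F Z\<close>, and by the finite set \<open>E\<close> of ones in its other
  columns.\<close>

lemma countable_range_F: "countable (range F)"
proof (rule countable_subset)
  let ?h = "\<lambda>(S, E) m. if m mod n \<in> S then F Z m else m \<in> (E :: nat set)"
  show "range F \<subseteq> ?h ` ({S. finite S} \<times> {E. finite E})"
  proof
    fix Y assume "Y \<in> range F"
    then obtain X where Y: "Y = F X" by blast
    define E where "E = {m. m mod n \<notin> inf_cols Y \<and> Y m}"
    have "\<exists>T. \<forall>i\<in>{..<n}. i \<notin> inf_cols Y \<longrightarrow> (\<forall>t\<ge>T. \<not> Y (n * t + i))"
    proof -
      have "\<forall>\<^sub>F T in sequentially. \<forall>i\<in>{..<n}. i \<notin> inf_cols Y \<longrightarrow> (\<forall>t\<ge>T. \<not> Y (n * t + i))"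
      proof (intro eventually_ball_finite ballI)
        fix i assume "i \<in> {..<n}"
        show "\<forall>\<^sub>F T in sequentially. i \<notin> inf_cols Y \<longrightarrow> (\<forall>t\<ge>T. \<not> Y (n * t + i))"
        proof (cases "i \<in> inf_cols Y")
          case False
          then obtain T where "\<forall>t\<ge>T. \<not> Y (n * t + i)"
            using \<open>i \<in> {..<n}\<close> by (auto simp: inf_cols_def inf_col_def)
          then show ?thesis unfolding eventually_sequentially by (intro exI[of _ T]) auto
        qed simp
      qed simp
      then show ?thesis by (rule eventually_happens'[OF sequentially_bot])
    qed
    then obtain T where T: "\<And>i t. i < n \<Longrightarrow> i \<notin> inf_cols Y \<Longrightarrow> t \<ge> T \<Longrightarrow> \<not> Y (n * t + i)" by blast
    have "E \<subseteq> {..<n * T}"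
    proof
      fix m assume m: "m \<in> E"
      obtain i t where it: "i < n" "m = n * t + i" by (rule column_cases)
      then have "\<not> t \<ge> T" using T[of i t] m by (auto simp: E_def)
      then have "n * Suc t \<le> n * T" by (intro mult_le_mono2) simp
      then show "m \<in> {..<n * T}" using it by simp
    qed
    then have "finite E" by (rule finite_subset) simp
    moreover have "Y m = ?h (inf_cols Y, E) m" for m
    proof -
      obtain i t where it: "i < n" "m = n * t + i" by (rule column_cases)
      then show ?thesis using inf_col_F_eq[OF it(1), of X t] by (auto simp: E_def inf_cols_def Y)
    qed
    ultimately show "Y \<in> ?h ` ({S. finite S} \<times> {E. finite E})"
      by (intro image_eqI[of _ _ "(inf_cols Y, E)"]) auto
  qed
  show "countable (?h ` ({S. finite S} \<times> {E. finite E}))"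
    by (intro countable_image countable_SIGMA countable_Collect_finite)
qed

section \<open>Iterated derivatives of the range\<close>

text \<open>A long common prefix fixes the finite columns, so nearby points have no further infinite
  ones. Having at least \<open>k\<close> of them, they have the same ones, whose values are forced
  by \<open>inf_col_F_eq\<close>.\<close>

lemma isolated_minimal_inf_cols:
  assumes "card (inf_cols (F X)) = k"
  shows "F X isolated_in {Y \<in> range F. k \<le> card (inf_cols Y)}"
proof -
  have "\<forall>i. \<exists>L. i < n \<longrightarrow> i \<notin> inf_cols (F X) \<longrightarrow>
      (\<forall>Y. (\<forall>m<L. F Y m = F X m) \<longrightarrow> (\<forall>t. F Y (n * t + i) = F X (n * t + i)))"
    using finite_col_isolated by (auto simp: inf_cols_def)
  then obtain L where L: "\<And>i Y t. i < n \<Longrightarrow> i \<notin> inf_cols (F X) \<Longrightarrow>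
      (\<forall>m<L i. F Y m = F X m) \<Longrightarrow> F Y (n * t + i) = F X (n * t + i)"
    by metis
  have "F Y = F X" if "k \<le> card (inf_cols (F Y))" and eq: "\<forall>m<sum L {..<n}. F Y m = F X m" for Y
  proof -
    have cols: "F Y (n * t + i) = F X (n * t + i)" if i: "i < n" "i \<notin> inf_cols (F X)" for i t
    proof (rule L[OF i])
      have "L i \<le> sum L {..<n}" using i(1) by (intro member_le_sum) auto
      then show "\<forall>m<L i. F Y m = F X m" using eq by auto
    qed
    have "inf_cols (F Y) \<subseteq> inf_cols (F X)"
    proof (rule subsetI, rule ccontr)
      fix i assume "i \<in> inf_cols (F Y)" "i \<notin> inf_cols (F X)"
      then show False using cols[of i] by (simp add: inf_cols_def inf_col_def) blast
    qed
    then have "inf_cols (F Y) = inf_cols (F X)"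
      using that(1) assms by (intro card_seteq) auto
    then show ?thesis using cols by (rule range_F_eqI)
  qed
  then show ?thesis using assms unfolding isolated_in_cantor_iff
    by (intro conjI exI[of _ "sum L {..<n}"]) auto
qed

lemma not_isolated_inf_cols:
  assumes "k < card (inf_cols (F X))"
  shows "\<not> F X isolated_in {Y \<in> range F. k \<le> card (inf_cols Y)}"
proof
  assume "F X isolated_in {Y \<in> range F. k \<le> card (inf_cols Y)}"
  then obtain l where l: "\<And>Y. k \<le> card (inf_cols (F Y)) \<Longrightarrow> \<forall>m<l. F Y m = F X m \<Longrightarrow> F Y = F X"
    unfolding isolated_in_cantor_iff by blast
  have "inf_cols (F X) \<noteq> {}" using assms by auto
  then obtain i where "i \<in> inf_cols (F X)" by blast
  then have i: "i < n" "inf_col (F X) i" by (simp_all add: inf_cols_def)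
  \<comment> \<open>Changing one late bit of an infinite column makes that column finite, keeps the
    other infinite columns, and leaves the output below \<open>l\<close> unchanged because
    \<open>l \<le> n * l\<close>.\<close>
  define Y where "Y = X(n * l + i := \<not> X (n * l + i))"
  have off: "Y m = X m" if "m \<noteq> n * l + i" for m using that by (simp add: Y_def)
  have "l \<le> n * l" using n_pos by (cases n) auto
  have "F Y m = F X m" if "m < l" for m
  proof (rule causal)
    fix j assume "j \<le> m"
    then have "j \<noteq> n * l + i" using that \<open>l \<le> n * l\<close> by linarith
    then show "Y j = X j" by (rule off)
  qed
  moreover have "k \<le> card (inf_cols (F Y))"
  proof -
    have "inf_cols (F X) - {i} \<subseteq> inf_cols (F Y)"
    proof
      fix j assume j: "j \<in> inf_cols (F X) - {i}"
      have "n * k + j \<noteq> n * l + i" for k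
      proof
        assume "n * k + j = n * l + i"
        then have "(n * k + j) mod n = (n * l + i) mod n" by simp
        then show False using j i(1) by (simp add: inf_cols_def)
      qed
      then show "j \<in> inf_cols (F Y)" using j off by (auto simp: inf_cols_def inf_col_F_iff)
    qed
    then have "card (inf_cols (F X) - {i}) \<le> card (inf_cols (F Y))" by (intro card_mono) simp_all
    then show ?thesis using assms \<open>i \<in> inf_cols (F X)\<close> by simp
  qed
  ultimately have "F Y = F X" using l by blast
  then have "inf_col (F Y) i" using i(2) by simp
  then have "Y (n * l + i) = X (n * l + i)" using i by (simp add: inf_col_F_iff)
  then show False by (simp add: Y_def)
qed

lemma CB_range_F: "CB (range F) (ord_of_nat k) = {Y \<in> range F. k \<le> card (inf_cols Y)}"
proof (induction k)
  case 0
  show ?case by (simp add: CB_zero)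
next
  case (Suc k)
  have "Y isolated_in {Y \<in> range F. k \<le> card (inf_cols Y)} \<longleftrightarrow> \<not> Suc k \<le> card (inf_cols Y)"
    if range: "Y \<in> range F" and k: "k \<le> card (inf_cols Y)" for Y
  proof -
    obtain X where Y: "Y = F X" using range by blast
    consider "card (inf_cols (F X)) = k" | "k < card (inf_cols (F X))"
      using k Y by (metis le_neq_implies_less)
    then show ?thesis
    proof cases
      case 1
      then show ?thesis using isolated_minimal_inf_cols[OF 1] by (simp add: Y)
    next
      case 2
      then show ?thesis using not_isolated_inf_cols[OF 2] by (simp add: Y)
    qed
  qed
  then show ?case by (auto simp: CB_succ Suc deriv_set_def)
qed


section \<open>Turing reductions between columns of \<open>Z\<close> and of
  \<open>F Z\<close>\<close>

text \<open>\<open>F\<close> is run on \<open>Z\<close> with the columns outside \<open>S\<close>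
  erased; by the independence of columns, the output on \<open>S\<close> stays the same.\<close>

lemma columns_F_turing_le:
  assumes "finite S"
  shows "(\<lambda>m. m mod n \<in> S \<and> F Z m) \<le>\<^sub>T (\<lambda>m. m mod n \<in> S \<and> Z m)"
proof -
  let ?B = "\<lambda>m. m mod n \<in> S \<and> Z m"
  have "dec_pred ?B (\<lambda>v. ?B (v 0))" by (intro dec_pred_oracle rec_intros)
  then have "dec_pred ?B (\<lambda>v. F ?B (v 0))" by (rule dec_F_oracle)
  then have dec: "dec_pred ?B (\<lambda>v. v 0 mod n \<in> S \<and> F ?B (v 0))" by (intro rec_intros assms)
  have eq: "F ?B m = F Z m" if "m mod n \<in> S" for m
  proof -
    obtain i t where it: "i < n" "m = n * t + i" by (rule column_cases)
    then show ?thesis using that by (auto intro!: F_column_cong)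
  qed
  have "m mod n \<in> S \<and> F ?B m \<longleftrightarrow> m mod n \<in> S \<and> F Z m" for m using eq by blast
  with dec show ?thesis unfolding turing_le_iff by (simp only:)
qed

text \<open>A success on the column of \<open>m\<close> with count at least \<open>m div n\<close>
  certifies that the approximation of that stage is correct at \<open>m\<close>. Such a stage exists
  because every column of \<open>F Z\<close> is infinite.\<close>

lemma turing_le_columns_F:
  assumes "finite S"
  shows "(\<lambda>m. m mod n \<in> S \<and> Z m) \<le>\<^sub>T (\<lambda>m. m mod n \<in> S \<and> F Z m)"
proof -
  let ?B = "\<lambda>m. m mod n \<in> S \<and> F Z m"
  \<comment> \<open>The count is expressed through the oracle, and the first disjunct keeps the
    search total for columns outside \<open>S\<close>.\<close>
  define Q where "Q m t \<longleftrightarrow> m mod n \<notin> S \<or>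
      ?B (n * t + m mod n) \<and> m div n \<le> card {s. s < t \<and> ?B (n * s + m mod n)}" for m t
  have Q: "Q m t \<longleftrightarrow> m mod n \<notin> S \<or> F Z (n * t + m mod n) \<and> m div n \<le> cnt Z (m mod n) t" for m t
    using n_pos by (auto simp: Q_def cnt_eq_card)
  have ex: "\<exists>t. Q m t" for m
  proof -
    have i: "m mod n < n" using n_pos by simp
    then have inf: "inf_col (F Z) (m mod n)" by (simp add: inf_col_F_iff)
    then obtain s where s: "m div n \<le> cnt Z (m mod n) s" using inf_col_cnt_unbounded[OF i] by blast
    obtain t where "t \<ge> s" "F Z (n * t + m mod n)" using inf unfolding inf_col_def by blast
    then show ?thesis using s cnt_mono[OF i, of s t Z] unfolding Q by (meson order_trans)
  qed
  have correct: "m mod n \<in> S \<and> g (LEAST t. Q m t) m \<longleftrightarrow> m mod n \<in> S \<and> Z m" for m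
  proof (cases "m mod n \<in> S")
    case True
    have i: "m mod n < n" using n_pos by simp
    let ?t = "LEAST t. Q m t"
    have "F Z (n * ?t + m mod n)" "m div n \<le> cnt Z (m mod n) ?t"
      using LeastI_ex[OF ex[of m]] True unfolding Q by auto
    then have "Z (n * (m div n) + m mod n) = g ?t (n * (m div n) + m mod n)"
      by (simp only: F_column[OF i] agree_def)
    then show ?thesis by simp
  qed simp
  have B: "dec_pred ?B (\<lambda>v. ?B (a v))" if "rec_fun ?B a" for a
    using dec_pred_oracle[OF that] .
  have "rec_fun ?B (\<lambda>v. LEAST t. Q (v 0) t)"
    unfolding Q_def[abs_def]
    using ex by (intro rec_fun_Least) (intro rec_intros B assms, simp add: Q_def)
  then have "dec_pred ?B (\<lambda>v. v 0 mod n \<in> S \<and> g (LEAST t. Q (v 0) t) (v 0))"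
    by (intro rec_intros assms dec_pred_lift2[OF dec_g])
  then show ?thesis unfolding correct turing_le_iff .
qed

lemma F_turing_equiv: "(Z, F Z) \<in> turing_equiv"
proof -
  have "(\<lambda>m. m mod n \<in> {..<n} \<and> Y m) = Y" for Y :: "nat \<Rightarrow> bool" using n_pos by simp
  then show ?thesis
    using columns_F_turing_le[of "{..<n}"] turing_le_columns_F[of "{..<n}"] by (simp add: turing_equiv_def)
qed


section \<open>Ranks in arbitrary \<open>\<Pi>\<^sup>0\<^sub>1\<close> classes\<close>

text \<open>The induction hypothesis is applied to a whole fibre, all members of \<open>Q\<close>
  that share with \<open>X\<close> the columns in \<open>S\<close>; hence the generality in
  \<open>X\<close>. The fibre lies in the derivative, so isolation there becomes isolation in the
  fibre and \<open>isolated_fibre_turing_le\<close> applies.\<close>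

lemma CB_of_columns:
  assumes random: "martin_lof_random lebesgue_cantor Z"
    and Q: "Pi01_class Q" and S: "S \<subseteq> {..<n}"
  shows "X \<in> Q \<Longrightarrow> (\<And>m. m mod n \<in> S \<Longrightarrow> X m = F Z m) \<Longrightarrow> X \<in> CB Q (ord_of_nat (card S))"
proof -
  have "finite S" using S by (rule finite_subset) simp
  then show "X \<in> Q \<Longrightarrow> (\<And>m. m mod n \<in> S \<Longrightarrow> X m = F Z m) \<Longrightarrow> X \<in> CB Q (ord_of_nat (card S))"
    using S
  proof (induction S arbitrary: X)
    case empty
    then show ?case by (simp add: CB_zero)
  next
    case (insert i S)
    have i: "i < n" using insert.prems(3) by simp
    have fibre: "{Y \<in> Q. \<forall>m. m mod n \<in> S \<longrightarrow> Y m = X m} \<subseteq> CB Q (ord_of_nat (card S))"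
    proof
      fix Y assume "Y \<in> {Y \<in> Q. \<forall>m. m mod n \<in> S \<longrightarrow> Y m = X m}"
      then show "Y \<in> CB Q (ord_of_nat (card S))" using insert.prems by (intro insert.IH) auto
    qed
    have "\<not> X isolated_in CB Q (ord_of_nat (card S))"
    proof
      assume "X isolated_in CB Q (ord_of_nat (card S))"
      then have "X isolated_in {Y \<in> Q. \<forall>m. m mod n \<in> S \<longrightarrow> Y m = X m}"
        using fibre insert.prems(1) unfolding isolated_in_cantor_iff by blast
      then have "X \<le>\<^sub>T (\<lambda>m. m mod n \<in> S \<and> X m)"
        by (intro isolated_fibre_turing_le[OF Q]) (intro rec_intros insert.hyps(1))
      also have "(\<lambda>m. m mod n \<in> S \<and> X m) = (\<lambda>m. m mod n \<in> S \<and> F Z m)"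
        using insert.prems(2) by auto
      finally have "X \<le>\<^sub>T (\<lambda>m. m mod n \<in> S \<and> Z m)"
        using columns_F_turing_le[OF insert.hyps(1)] turing_le_trans by blast
      moreover have "(\<lambda>m. m mod n \<in> insert i S \<and> Z m) \<le>\<^sub>T X"
      proof -
        have "dec_pred X (\<lambda>v. v 0 mod n \<in> insert i S \<and> X (v 0))"
          by (intro rec_intros dec_pred_oracle) (use insert.hyps(1) in simp)
        then have "(\<lambda>m. m mod n \<in> insert i S \<and> X m) \<le>\<^sub>T X" by (simp only: turing_le_iff)
        also have "(\<lambda>m. m mod n \<in> insert i S \<and> X m) = (\<lambda>m. m mod n \<in> insert i S \<and> F Z m)"
          using insert.prems(2) by blast
        finally show ?thesis
          using turing_le_columns_F[of "insert i S"] insert.hyps(1) turing_le_trans by blast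
      qed
      ultimately have "(\<lambda>m. m mod n \<in> insert i S \<and> Z m) \<le>\<^sub>T (\<lambda>m. m mod n \<in> S \<and> Z m)"
        using turing_le_trans by blast
      \<comment> \<open>Column \<open>i\<close> occupies the positions \<open>n * k + i\<close>,
        away from the columns in \<open>S\<close>. There the computed set coincides with
        \<open>Z\<close>, so no \<open>k\<close> can witness a difference.\<close>
      then have "\<exists>k. ((n * k + i) mod n \<in> insert i S \<and> Z (n * k + i)) \<noteq> Z (n * k + i)"
      proof (rule random_not_computed_from_other_bits[OF random, rotated -1])
        show "dec_pred (\<lambda>_. False) (\<lambda>v. v 0 mod n \<in> S)" by (intro rec_intros insert.hyps(1))
        show "rec_fun (\<lambda>_. False) (\<lambda>v. n * v 0 + i)" by (intro rec_intros)
        show "inj (\<lambda>k. n * k + i)" using n_pos by (auto intro: injI)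
        show "(n * k + i) mod n \<notin> S" for k using i insert.hyps(2) by simp
      qed
      then show False using i by simp
    qed
    then have "X \<in> CB Q (osucc (ord_of_nat (card S)))"
      using fibre insert.prems(1) by (auto simp: CB_succ deriv_set_def)
    then show ?case using insert.hyps by simp
  qed
qed

text \<open>\<open>CB_range_F\<close> gives the rank within the range. \<open>CB_of_columns\<close>,
  applied to the infinite columns of \<open>Y\<close>, shows that no other class gives a smaller
  one.\<close>

lemma rank_range_F:
  assumes random: "martin_lof_random lebesgue_cantor Z" and Y: "Y \<in> range F"
  shows "has_rk_in (range F) Y" and "rk_in (range F) Y = ord_of_nat (card (inf_cols Y))"
    and "rk Y = ord_of_nat (card (inf_cols Y))"
proof -
  let ?k = "card (inf_cols Y)"
  have CB: "Y \<in> CB (range F) (ord_of_nat ?k)" "Y \<notin> CB (range F) (osucc (ord_of_nat ?k))"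
    using Y CB_range_F[of ?k] CB_range_F[of "Suc ?k"] by auto
  then show "has_rk_in (range F) Y" unfolding has_rk_in_def by blast
  show "rk_in (range F) Y = ord_of_nat ?k" using CB by (rule rk_in_eqI)
  show "rk Y = ord_of_nat ?k"
  proof (rule rk_eqI[OF Pi01_class_range CB])
    fix Q assume "Pi01_class Q" "Y \<in> Q"
    show "Y \<in> CB Q (ord_of_nat ?k)"
    proof (rule CB_of_columns[OF random \<open>Pi01_class Q\<close> _ \<open>Y \<in> Q\<close>])
      show "inf_cols Y \<subseteq> {..<n}" by (auto simp: inf_cols_def)
      fix m assume m: "m mod n \<in> inf_cols Y"
      obtain i t where it: "i < n" "m = n * t + i" by (rule column_cases)
      obtain X where "Y = F X" using Y by blast
      then show "Y m = F Z m" using inf_col_F_eq[OF it(1), of X t] m it by (simp add: inf_cols_def)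
    qed
  qed
qed

end

section \<open>The measure and the sequence for a given degree\<close>

theorem theorem3p4:
  fixes r :: "(nat \<Rightarrow> bool) set" and n :: nat
  assumes "Delta02_random_degree r" and "n \<ge> 1"
  shows "\<exists>(\<mu> :: (nat \<Rightarrow> bool) measure) (R :: nat \<Rightarrow> bool).
      probability_on_cantor \<mu> \<and> computable_measure \<mu> \<and> countably_supported \<mu> \<and>
      R \<in> r \<and>
      martin_lof_random \<mu> R \<and>
      (ranked R \<and> rk R = ord_of_nat n) \<and>
      rank_faithful (support \<mu>)"
proof -
  obtain X Z where X: "X \<in> r" "Delta02 X" and Z: "Z \<in> r" "martin_lof_random lebesgue_cantor Z"
    and r: "r \<in> UNIV // turing_equiv"
    using assms(1) unfolding Delta02_random_degree_def turing_degrees_def by blast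
  \<comment> \<open>The \<open>\<Delta>\<^sup>0\<^sub>2\<close> member \<open>X\<close> and the
    random member \<open>Z\<close> may differ; the reduction of \<open>Z\<close> to \<open>X\<close>
    carries the approximation over to \<open>Z\<close>.\<close>
  have "(Z, X) \<in> turing_equiv" using quotient_eq_iff[OF equiv_turing_equiv r r] X Z by blast
  then have "Z \<le>\<^sub>T X" by (simp add: turing_equiv_def)
  then obtain g where g: "limit_computes g Z"
    using Delta02_limit_computes[OF X(2)] limit_computes_turing_le by blast
  interpret column_matching n g Z
    by unfold_locales (use assms(2) g in auto)
  have "F Z \<in> r" using in_quotient_imp_closed[OF equiv_turing_equiv r Z(1) F_turing_equiv] .
  moreover have "martin_lof_random \<mu> (F Z)" using Z(2) by (rule martin_lof_random)
  moreover have "ranked (F Z)"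
    using Pi01_class_range rank_range_F(1)[OF Z(2)] unfolding ranked_def by blast
  moreover have "rk (F Z) = ord_of_nat n"
  proof -
    \<comment> \<open>On input \<open>Z\<close> every column is the correct one, so all
      \<open>n\<close> output columns are infinite.\<close>
    have "inf_cols (F Z) = {..<n}" by (auto simp: inf_cols_def inf_col_F_iff)
    then show ?thesis using rank_range_F(3)[OF Z(2), of "F Z"] by simp
  qed
  moreover have "rank_faithful (support \<mu>)"
    using Pi01_class_range rank_range_F[OF Z(2)] unfolding rank_faithful_def support_eq by simp
  ultimately show ?thesis
    using probability_on_cantor computable_measure countably_supported[OF countable_range_F] by blast
qed

end
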